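(* For every integer $n\ge 3$, the posets $NC^{(B)}(n-1,1)$ and $NC^{(B)}(n)$ are not isomorphic.
   Context: $NC^{(B)}(n)$ denotes Reiner's lattice of non-crossing partitions of type B: the partitions $\pi$ of $\{\pm1,\ldots,\pm n\}$ such that $-A$ is a block of $\pi$ whenever $A$ is a block of $\pi$, and which are non-crossing with respect to the cyclic order $1,2,\ldots,n,-1,-2,\ldots,-n$ (i.e. when these $2n$ points are placed in this order around a circle, the convex hulls of distinct blocks are disjoint); it is partially ordered by $\pi\le\rho$ if and only if every block of $\pi$ is contained in a block of $\rho$. Let $p,q$ be positive integers and $N = p+q$ (in the claim, $p=n-1$, $q=1$, $N=n$). The hyperoctahedral group $B_N$ is the group of permutations $\tau$ of $\{\pm 1,\ldots,\pm N\}$ with $\tau(-i) = -\tau(i)$ for $1\le i\le N$. It is generated by the set consisting of the elements $(i,j)(-i,-j)$ and $(i,-j)(-i,j)$ for $1\le i,j\le N$, $i\neq j$, and the elements $(i,-i)$ for $1\le i\le N$. For $\tau\in B_N$, let $\ell_B(\tau)$ be the smallest $k\ge 0$ such that $\tau$ is a product of $k$ of these generators (the empty product being the identity). The partial order on $B_N$ is: $\tau\le\sigma$ if and only if $\ell_B(\sigma)=\ell_B(\tau)+\ell_B(\tau^{-1}\sigma)$. Let $\gamma_{p,q}\in B_N$ be the permutation with two cycles $$\gamma_{p,q} = (1,\ldots,p,-1,\ldots,-p)\,(p+1,\ldots,p+q,-(p+1),\ldots,-(p+q)),$$ and let $\mathcal{S}^{(B)}_{nc}(p,q) = \{\tau\in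 B_N \mid \tau\le\gamma_{p,q}\}$. For $\tau\in B_N$, let $\Omega(\tau)$ be the partition of $\{\pm1,\ldots,\pm N\}$ into orbits of $\tau$, and let $\widetilde{\Omega}(\tau)$ be the partition obtained from $\Omega(\tau)$ by merging all inversion-invariant blocks (blocks $A$ with $A=-A$), if any exist, into one single block. Define $NC^{(B)}(p,q) = \{\widetilde{\Omega}(\tau)\mid \tau\in \mathcal{S}^{(B)}_{nc}(p,q)\}$, partially ordered by $\pi\le\rho$ if and only if every block of $\pi$ is contained in a block of $\rho$. *)

theory Defs
  imports
    "HOL-Analysis.Analysis"
    "HOL-Combinatorics.Cycles"
    "HOL-Combinatorics.Orbits"
begin

definition order_isomorphic ::
    "'a set \<Rightarrow> ('a \<Rightarrow> 'a \<Rightarrow> bool) \<Rightarrow> 'b set \<Rightarrow> ('b \<Rightarrow> 'b \<Rightarrow> bool) \<Rightarrow> bool" where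
  "order_isomorphic A le\<^sub>A B le\<^sub>B \<longleftrightarrow>
     (\<exists>f. bij_betw f A B \<and> (\<forall>x\<in>A. \<forall>y\<in>A. le\<^sub>A x y \<longleftrightarrow> le\<^sub>B (f x) (f y)))"

definition signed :: "nat \<Rightarrow> int set" where
  "signed N = {i. 1 \<le> \<bar>i\<bar> \<and> \<bar>i\<bar> \<le> int N}"


subsection \<open>Non-crossing partitions of type B\<close>

text \<open>The angles of \<open>1, \<dots>, n, -1, \<dots>, -n\<close> are \<open>\<pi>k/n\<close> for \<open>k = 1, \<dots>, 2n\<close>, so the
  \<open>2n\<close> points are equally spaced on the unit circle in this order.\<close>

definition circle_point :: "nat \<Rightarrow> int \<Rightarrow> complex" where
  "circle_point n i =
     cis (pi * of_int (if 0 < i then i else int n + \<bar>i\<bar>) / of_nat n)"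

definition noncrossing :: "nat \<Rightarrow> int set set \<Rightarrow> bool" where
  "noncrossing n P \<longleftrightarrow>
     (\<forall>A\<in>P. \<forall>B\<in>P. A \<noteq> B \<longrightarrow>
        convex hull (circle_point n ` A) \<inter> convex hull (circle_point n ` B) = {})"

definition NC_B :: "nat \<Rightarrow> int set set set" where
  "NC_B n = {P. partition_on (signed n) P \<and> (\<forall>A\<in>P. uminus ` A \<in> P) \<and> noncrossing n P}"


subsection \<open>The hyperoctahedral group\<close>

definition hyperoctahedral :: "nat \<Rightarrow> (int \<Rightarrow> int) set" where
  "hyperoctahedral N =
     {\<tau>. \<tau> permutes signed N \<and> (\<forall>i\<in>{1..int N}. \<tau> (- i) = - \<tau> i)}"

definition generators_B :: "nat \<Rightarrow> (int \<Rightarrow> int) set" where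
  "generators_B N =
     {Transposition.transpose i j \<circ> Transposition.transpose (- i) (- j) | i j.
        i \<in> {1..int N} \<and> j \<in> {1..int N} \<and> i \<noteq> j} \<union>
     {Transposition.transpose i (- j) \<circ> Transposition.transpose (- i) j | i j.
        i \<in> {1..int N} \<and> j \<in> {1..int N} \<and> i \<noteq> j} \<union>
     {Transposition.transpose i (- i) | i. i \<in> {1..int N}}"

definition length_B :: "nat \<Rightarrow> (int \<Rightarrow> int) \<Rightarrow> nat" where
  "length_B N \<tau> =
     (LEAST k. \<exists>ts. length ts = k \<and> set ts \<subseteq> generators_B N \<and> foldr (\<circ>) ts id = \<tau>)"

definition le_B :: "nat \<Rightarrow> (int \<Rightarrow> int) \<Rightarrow> (int \<Rightarrow> int) \<Rightarrow> bool" where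
  "le_B N \<tau> \<sigma> \<longleftrightarrow> length_B N \<sigma> = length_B N \<tau> + length_B N (inv \<tau> \<circ> \<sigma>)"


subsection \<open>Annular non-crossing partitions of type B\<close>

definition gamma_B :: "nat \<Rightarrow> nat \<Rightarrow> int \<Rightarrow> int" where
  "gamma_B p q =
     (let xs = [1..int p]; ys = [int p + 1..int (p + q)]
      in cycle_of_list (xs @ map uminus xs) \<circ> cycle_of_list (ys @ map uminus ys))"

definition S_nc_B :: "nat \<Rightarrow> nat \<Rightarrow> (int \<Rightarrow> int) set" where
  "S_nc_B p q = {\<tau> \<in> hyperoctahedral (p + q). le_B (p + q) \<tau> (gamma_B p q)}"

definition orbit_partition :: "nat \<Rightarrow> (int \<Rightarrow> int) \<Rightarrow> int set set" where
  "orbit_partition N \<tau> = orbit \<tau> ` signed N"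

definition merge_invariant_blocks :: "int set set \<Rightarrow> int set set" where
  "merge_invariant_blocks P =
     (let Z = {A \<in> P. uminus ` A = A}
      in if Z = {} then P else insert (\<Union>Z) (P - Z))"

definition NC_B_annular :: "nat \<Rightarrow> nat \<Rightarrow> int set set set" where
  "NC_B_annular p q = (\<lambda>\<tau>. merge_invariant_blocks (orbit_partition (p + q) \<tau>)) ` S_nc_B p q"

end

theory Submission
  imports Defs
begin

text \<open>
  Isomorphic finite posets have the same number of elements with exactly five elements weakly
  below them. The idea is to compare these elements, which are the joins of type \<open>A\<^sub>2\<close> of two atoms.
  In \<open>NC\<^sup>B(n)\<close> each of them is a partition whose only blocks with more than one element are \<open>T\<close> and
  \<open>- T\<close>, where \<open>T\<close> has three elements and is disjoint from \<open>- T\<close> (lemma \<open>NC_B_down_five\<close>); the number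
  five counts the partitions of \<open>T\<close>.

  Let \<open>i < j < k\<close> be the absolute values of the elements of \<open>T\<close>. Up to a global sign there are four
  choices of signs. When all \<open>2n\<close> points are on one circle, the choice \<open>{i, - j, k}\<close> is forbidden, since
  this triangle and its negative both contain the centre (lemma \<open>crossing_triple\<close>). The other three
  choices also occur in the annular poset, and there they have five elements below them as well
  (lemmas \<open>triple_annular_or_crossing\<close> and \<open>annular_triple_card\<close>). But for \<open>k = n\<close> the points \<open>\<plusminus>n\<close>
  sit on a circle of their own and can be paired with the outer points with either sign, so the
  fourth choice becomes available too; such a triple exists as soon as \<open>n - 1 \<ge> 2\<close>. Hence one finite
  set of partitions is properly contained in the other (lemma \<open>five_below_strict\<close>), and the two
  cardinalities differ.

  Membership in the annular poset is a statement about lengths in the hyperoctahedral group. The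
  length of \<open>\<gamma>\<close> is at least \<open>n\<close>, because a product of fewer than \<open>n\<close> reflections leaves a non-zero odd
  function invariant, by linear algebra, and \<open>\<gamma>\<close> leaves none invariant (lemmas \<open>short_word_invariant_function\<close>
  and \<open>gam_word_length\<close>). So every prefix of a word of length \<open>n\<close> for \<open>\<gamma>\<close> lies below \<open>\<gamma>\<close>. Such a word
  beginning with the rotation \<open>\<tau> = (a, b, c)(- a, - b, - c)\<close> exists because \<open>\<tau>\<^sup>-\<^sup>1\<gamma>\<close> has two pairs of
  opposite cycles: the pairs of cycles reduce the number of reflections that are needed, and a
  labelling of the points that is constant on cycles witnesses them (lemma \<open>word_from_labels\<close>).
\<close>

section \<open>Reflections and words in the hyperoctahedral group\<close>

text \<open>
  For \<open>y = - x\<close> this is the transposition \<open>(x, - x)\<close>; otherwise it is \<open>(x, y)(- x, - y)\<close>. All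
  generators of the hyperoctahedral group thus have one common form.
\<close>

definition reflection :: "int \<Rightarrow> int \<Rightarrow> int \<Rightarrow> int" where
  "reflection x y z =
     (if z = x then y else if z = y then x
      else if z = - x then - y else if z = - y then - x else z)"

lemma reflection_reflection: "x \<noteq> 0 \<Longrightarrow> y \<noteq> 0 \<Longrightarrow> reflection x y (reflection x y z) = z"
  by (auto simp: reflection_def split: if_splits)

lemma reflection_neg: "x \<noteq> 0 \<Longrightarrow> y \<noteq> 0 \<Longrightarrow> reflection (- x) (- y) = reflection x y"
  by (auto simp: reflection_def fun_eq_iff)

lemma reflection_minus: "x \<noteq> 0 \<Longrightarrow> y \<noteq> 0 \<Longrightarrow> reflection x y (- z) = - reflection x y z"
  by (auto simp: reflection_def)

lemma signed_0 [simp]: "0 \<notin> signed N"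
  by (simp add: signed_def)

lemma signed_minus [simp]: "- x \<in> signed N \<longleftrightarrow> x \<in> signed N"
  by (simp add: signed_def)

lemma finite_signed [simp]: "finite (signed N)"
  by (rule finite_subset[of _ "{- int N..int N}"]) (auto simp: signed_def)

lemma card_signed: "card (signed N) = 2 * N"
proof -
  have "signed N = {1..int N} \<union> {- int N..- 1}"
    by (auto simp: signed_def)
  then show ?thesis
    by (simp add: card_Un_disjoint)
qed

lemma involution_permutes:
  assumes "\<And>z. f (f z) = z" "\<And>z. z \<notin> S \<Longrightarrow> f z = z"
  shows "f permutes S"
  unfolding permutes_def using assms by metis

lemma reflection_permutes:
  assumes "x \<in> S" "y \<in> S" "- x \<in> S" "- y \<in> S" "x \<noteq> 0" "y \<noteq> 0"
  shows "reflection x y permutes S"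
proof (rule involution_permutes)
  show "reflection x y (reflection x y z) = z" for z using assms by (simp add: reflection_reflection)
  show "reflection x y z = z" if "z \<notin> S" for z using assms that by (auto simp: reflection_def)
qed

lemma reflection_transpose:
  fixes i j :: int
  assumes "0 < i" "0 < j"
  shows "Transposition.transpose i (- i) = reflection i (- i)"
    and "i \<noteq> j \<Longrightarrow> Transposition.transpose i j \<circ> Transposition.transpose (- i) (- j) = reflection i j"
    and "i \<noteq> j \<Longrightarrow> Transposition.transpose i (- j) \<circ> Transposition.transpose (- i) j = reflection i (- j)"
proof -
  have ne: "i \<noteq> - i" "- i \<noteq> i" "j \<noteq> - j" "- j \<noteq> j" "i \<noteq> - j" "j \<noteq> - i" "- i \<noteq> j" "- j \<noteq> i" "i \<noteq> 0" "j \<noteq> 0"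
    using assms by linarith+
  show "Transposition.transpose i (- i) = reflection i (- i)"
    by (rule ext) (simp add: reflection_def Transposition.transpose_def ne)
  assume "i \<noteq> j"
  note ne = ne this this[symmetric]
  show "Transposition.transpose i j \<circ> Transposition.transpose (- i) (- j) = reflection i j"
    by (rule ext) (simp add: reflection_def Transposition.transpose_def ne)
  show "Transposition.transpose i (- j) \<circ> Transposition.transpose (- i) j = reflection i (- j)"
    by (rule ext) (simp add: reflection_def Transposition.transpose_def ne)
qed

lemma generators_eq: "generators_B N = {reflection x y |x y. x \<in> signed N \<and> y \<in> signed N \<and> x \<noteq> y}"
proof (intro set_eqI iffI)
  fix t assume "t \<in> generators_B N"
  then consider i j where "t = Transposition.transpose i j \<circ> Transposition.transpose (- i) (- j)"
      "i \<in> {1..int N}" "j \<in> {1..int N}" "i \<noteq> j"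
    | i j where "t = Transposition.transpose i (- j) \<circ> Transposition.transpose (- i) j"
      "i \<in> {1..int N}" "j \<in> {1..int N}" "i \<noteq> j"
    | i where "t = Transposition.transpose i (- i)" "i \<in> {1..int N}"
    unfolding generators_B_def by blast
  then have "\<exists>i j. t = reflection i j \<and> i \<in> signed N \<and> j \<in> signed N \<and> i \<noteq> j"
  proof cases
    case (1 i j)
    then have "t = reflection i j" using reflection_transpose(2)[of i j] by simp
    with 1 show ?thesis by (intro exI[of _ i] exI[of _ j]) (simp add: signed_def)
  next
    case (2 i j)
    then have "t = reflection i (- j)" using reflection_transpose(3)[of i j] by simp
    with 2 show ?thesis by (intro exI[of _ i] exI[of _ "- j"]) (simp add: signed_def)
  next
    case (3 i)
    then have "t = reflection i (- i)" using reflection_transpose(1)[of i i] by simp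
    with 3 show ?thesis by (intro exI[of _ i] exI[of _ "- i"]) (simp add: signed_def)
  qed
  then show "t \<in> {reflection x y |x y. x \<in> signed N \<and> y \<in> signed N \<and> x \<noteq> y}" by blast
next
  fix t assume "t \<in> {reflection x y |x y. x \<in> signed N \<and> y \<in> signed N \<and> x \<noteq> y}"
  then obtain x y where xy: "t = reflection x y" "x \<in> signed N" "y \<in> signed N" "x \<noteq> y" by blast
  have nz: "x \<noteq> 0" "y \<noteq> 0" using xy by (auto simp: signed_def)
  obtain i j where ij: "t = reflection i j" "i \<in> signed N" "j \<in> signed N" "i \<noteq> j" "0 < i"
  proof (cases "0 < x")
    case True then show ?thesis using that xy by blast
  next
    case False
    show ?thesis
      by (rule that[of "- x" "- y"]) (use False xy nz in \<open>simp_all add: reflection_neg\<close>)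
  qed
  have i: "i \<in> {1..int N}" using ij by (simp add: signed_def)
  consider "j = - i" | "0 < j" | "j < 0" "j \<noteq> - i" using ij(3) by (fastforce simp: signed_def)
  then show "t \<in> generators_B N"
  proof cases
    case 1
    then have "t = Transposition.transpose i (- i)" using ij(1,5) reflection_transpose(1)[of i i] by simp
    with i show ?thesis unfolding generators_B_def by blast
  next
    case 2
    then have "t = Transposition.transpose i j \<circ> Transposition.transpose (- i) (- j)"
      using ij(1,4,5) reflection_transpose(2)[of i j] by simp
    moreover have "j \<in> {1..int N}" using 2 ij by (simp add: signed_def)
    ultimately show ?thesis using i ij(4) unfolding generators_B_def by blast
  next
    case 3
    define k where "k = - j"
    have k: "j = - k" "k \<in> {1..int N}" "i \<noteq> k"
      using 3 ij(3) by (auto simp: signed_def k_def)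
    then have "t = Transposition.transpose i (- k) \<circ> Transposition.transpose (- i) k"
      using ij(1,5) reflection_transpose(3)[of i k] by simp
    with k i show ?thesis unfolding generators_B_def by blast
  qed
qed

definition word_for :: "nat \<Rightarrow> (int \<Rightarrow> int) \<Rightarrow> (int \<Rightarrow> int) list \<Rightarrow> bool" where
  "word_for N \<tau> ts \<longleftrightarrow> set ts \<subseteq> generators_B N \<and> foldr (\<circ>) ts id = \<tau>"

lemma word_for_append:
  assumes "word_for N \<sigma> ss" "word_for N \<tau> ts"
  shows "word_for N (\<sigma> \<circ> \<tau>) (ss @ ts)"
proof -
  have "foldr (\<circ>) ss \<rho> = foldr (\<circ>) ss id \<circ> \<rho>" for \<rho> :: "int \<Rightarrow> int"
    by (induction ss) (auto simp: o_assoc)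
  from this[of \<tau>] show ?thesis
    using assms by (auto simp: word_for_def)
qed

lemma word_for_Nil: "word_for N id []"
  by (simp add: word_for_def)

lemma word_for_Cons: "word_for N \<tau> ts \<Longrightarrow> x \<in> signed N \<Longrightarrow> y \<in> signed N \<Longrightarrow> x \<noteq> y \<Longrightarrow>
    word_for N (reflection x y \<circ> \<tau>) (reflection x y # ts)"
  by (auto simp: word_for_def generators_eq)

lemma length_B_le: "word_for N \<tau> ts \<Longrightarrow> length_B N \<tau> \<le> length ts"
  unfolding length_B_def word_for_def by (rule Least_le) blast

lemma length_B_attained: "word_for N \<tau> ts \<Longrightarrow> \<exists>ts'. word_for N \<tau> ts' \<and> length ts' = length_B N \<tau>"
  unfolding length_B_def word_for_def
  by (rule LeastI2_ex[where P = "\<lambda>k. \<exists>ts. length ts = k \<and> set ts \<subseteq> generators_B N \<and> foldr (\<circ>) ts id = \<tau>"]) blast+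

lemma hyper_minus:
  assumes "\<tau> \<in> hyperoctahedral N" shows "\<tau> (- x) = - \<tau> x"
proof -
  have p: "\<tau> permutes signed N" and o: "\<And>i. i \<in> {1..int N} \<Longrightarrow> \<tau> (- i) = - \<tau> i"
    using assms by (auto simp: hyperoctahedral_def)
  consider "x \<in> {1..int N}" | "- x \<in> {1..int N}" | "x \<notin> signed N"
    by (force simp: signed_def)
  then show ?thesis
  proof cases
    case 2 then show ?thesis using o[of "- x"] by simp
  next
    case 3 then show ?thesis using p by (simp add: permutes_not_in)
  qed (use o in simp)
qed

lemma hyperI: "\<tau> permutes signed N \<Longrightarrow> (\<And>x. \<tau> (- x) = - \<tau> x) \<Longrightarrow> \<tau> \<in> hyperoctahedral N"
  by (simp add: hyperoctahedral_def)

lemma word_hyper: "word_for N \<tau> ts \<Longrightarrow> \<tau> \<in> hyperoctahedral N"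
proof (induction ts arbitrary: \<tau>)
  case Nil
  then have "\<tau> = id" by (simp add: word_for_def)
  moreover have "id \<in> hyperoctahedral N" by (rule hyperI) (auto intro: permutes_id)
  ultimately show ?case by metis
next
  case (Cons t ts)
  then obtain x y where xy: "t = reflection x y" "x \<in> signed N" "y \<in> signed N"
    by (auto simp: word_for_def generators_eq)
  define \<rho> where "\<rho> = foldr (\<circ>) ts id"
  have \<tau>: "\<tau> = reflection x y \<circ> \<rho>" using Cons xy by (simp add: word_for_def \<rho>_def)
  have \<rho>: "\<rho> \<in> hyperoctahedral N"
    using Cons by (simp add: word_for_def \<rho>_def)
  have nz: "x \<noteq> 0" "y \<noteq> 0" using xy by (auto simp: signed_def)
  show ?case unfolding \<tau>
  proof (rule hyperI)
    show "reflection x y \<circ> \<rho> permutes signed N"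
      using \<rho> xy nz by (intro permutes_compose reflection_permutes) (auto simp: hyperoctahedral_def)
    show "(reflection x y \<circ> \<rho>) (- z) = - (reflection x y \<circ> \<rho>) z" for z
      by (simp add: hyper_minus[OF \<rho>] reflection_minus nz)
  qed
qed

text \<open>
  Upper bound for the length. A labelling that is constant on the cycles of \<open>\<sigma>\<close> and injective on
  the symmetric set \<open>R\<close> certifies that the points of \<open>R\<close> lie on pairwise distinct cycles, which
  are therefore not inversion-invariant. Any point \<open>i\<close> outside \<open>R\<close> can be removed from its cycle,
  together with \<open>- i\<close>, at the price of the single reflection that exchanges \<open>i\<close> and \<open>\<sigma> i\<close>: the label
  condition survives, and once only \<open>R\<close> is left, the permutation is the identity.
\<close>

lemma word_from_labels:
  fixes c :: "int \<Rightarrow> 'a"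
  assumes "S \<subseteq> signed N" "\<And>x. x \<in> S \<Longrightarrow> - x \<in> S"
    and "\<sigma> permutes S" "\<And>x. \<sigma> (- x) = - \<sigma> x"
    and "R \<subseteq> S" "\<And>x. x \<in> R \<Longrightarrow> - x \<in> R" "inj_on c R"
    and "\<And>x. x \<in> S \<Longrightarrow> c (\<sigma> x) = c x"
  shows "\<exists>ts. word_for N \<sigma> ts \<and> 2 * length ts \<le> card (S - R)"
  using assms
proof (induction "card (S - R)" arbitrary: S \<sigma> rule: less_induct)
  case less
  have finS: "finite S" using less.prems(1) finite_signed by (rule finite_subset)
  show ?case
  proof (cases "S = R")
    case True
    have "\<sigma> x = x" for x
    proof (cases "x \<in> S")
      case True
      then have "\<sigma> x \<in> S" using less.prems(3) permutes_in_image by metis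
      then show ?thesis using less.prems(7,8) True \<open>S = R\<close> by (metis inj_onD)
    next
      case False then show ?thesis using less.prems(3) by (simp add: permutes_not_in)
    qed
    then have "\<sigma> = id" by auto
    then show ?thesis using word_for_Nil by fastforce
  next
    case False
    then obtain i where i: "i \<in> S" "i \<notin> R" using less.prems(5) by blast
    have mi: "- i \<in> S" "- i \<notin> R" using i less.prems(2,6)[of i] less.prems(6)[of "- i"] by auto
    have i0: "i \<noteq> - i" using i(1) less.prems(1) by (auto simp: signed_def)
    define S' where "S' = S - {i, - i}"
    define \<sigma>' where "\<sigma>' = (if \<sigma> i = i then \<sigma> else reflection i (\<sigma> i) \<circ> \<sigma>)"
    have \<sigma>i: "\<sigma> i \<in> S" using i less.prems(3) permutes_in_image by metis
    have inj: "\<sigma> x = \<sigma> y \<longleftrightarrow> x = y" for x y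
      using less.prems(3) permutes_inj by (metis injD)
    have nz: "i \<noteq> 0" "\<sigma> i \<noteq> 0" using i \<sigma>i less.prems(1) by (auto simp: signed_def)
    have p: "reflection i (\<sigma> i) permutes S"
      using i(1) \<sigma>i nz less.prems(2) by (intro reflection_permutes) auto
    have card: "card (S - R) = card (S' - R) + 2"
    proof -
      have "S - R = insert i (insert (- i) (S' - R))" using i mi by (auto simp: S'_def)
      then show ?thesis using i0 finS by (simp add: S'_def)
    qed
    have odd': "\<sigma>' (- x) = - \<sigma>' x" for x
      by (simp add: \<sigma>'_def less.prems(4) reflection_minus nz)
    have fixi: "\<sigma>' i = i" by (simp add: \<sigma>'_def reflection_def)
    then have fixi': "\<sigma>' (- i) = - i" by (simp add: odd')
    have perm': "\<sigma>' permutes S"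
      unfolding \<sigma>'_def using less.prems(3) p by (auto intro: permutes_compose)
    have "\<exists>ts. word_for N \<sigma>' ts \<and> 2 * length ts \<le> card (S' - R)"
    proof (rule less.hyps)
      show "card (S' - R) < card (S - R)" using card by simp
      show "S' \<subseteq> signed N" using less.prems(1) by (auto simp: S'_def)
      show "- x \<in> S'" if "x \<in> S'" for x using that less.prems(2) by (auto simp: S'_def)
      show "\<sigma>' permutes S'"
        by (rule permutes_superset[OF perm']) (use fixi fixi' in \<open>auto simp: S'_def\<close>)
      show "\<sigma>' (- x) = - \<sigma>' x" for x by (rule odd')
      show "R \<subseteq> S'" using less.prems(5) i mi by (auto simp: S'_def)
      show "c (\<sigma>' x) = c x" if x: "x \<in> S'" for x
      proof -
        have xS: "x \<in> S" "x \<noteq> i" "x \<noteq> - i" using x by (auto simp: S'_def)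
        have cx: "c (\<sigma> x) = c x" using less.prems(8) xS by blast
        have ci: "c (\<sigma> i) = c i" "c (\<sigma> (- i)) = c (- i)" using less.prems(8) i mi by blast+
        have "\<sigma> x \<noteq> \<sigma> i" "\<sigma> x \<noteq> - \<sigma> i"
          using xS inj less.prems(4)[of i] by metis+
        then show ?thesis
          using cx ci by (auto simp: \<sigma>'_def reflection_def less.prems(4))
      qed
    qed (use less.prems in auto)
    then obtain ts where ts: "word_for N \<sigma>' ts" "2 * length ts \<le> card (S' - R)" by blast
    show ?thesis
    proof (cases "\<sigma> i = i")
      case True
      then show ?thesis using ts card by (intro exI[of _ ts]) (auto simp: \<sigma>'_def)
    next
      case False
      then have "\<sigma> = reflection i (\<sigma> i) \<circ> \<sigma>'" by (auto simp: \<sigma>'_def fun_eq_iff reflection_reflection nz)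
      moreover have "word_for N (reflection i (\<sigma> i) \<circ> \<sigma>') (reflection i (\<sigma> i) # ts)"
        using ts False i \<sigma>i less.prems(1) by (intro word_for_Cons) auto
      ultimately show ?thesis using ts card by (intro exI[of _ "reflection i (\<sigma> i) # ts"]) auto
    qed
  qed
qed

lemma homogeneous_system_nontrivial:
  fixes cs :: "('i \<Rightarrow> real) list"
  assumes "finite I" "length cs < card I"
  shows "\<exists>w. (\<exists>i\<in>I. w i \<noteq> 0) \<and> (\<forall>c\<in>set cs. (\<Sum>i\<in>I. c i * w i) = 0)"
  using assms
proof (induction "length cs" arbitrary: cs I)
  case 0
  then have "I \<noteq> {}" by auto
  with 0 show ?case by (intro exI[of _ "\<lambda>_. 1"]) auto
next
  case (Suc k)
  then obtain c cs' where cs: "cs = c # cs'" by (cases cs) auto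
  show ?case
  proof (cases "\<forall>i\<in>I. c i = 0")
    case True
    have "\<exists>w. (\<exists>i\<in>I. w i \<noteq> 0) \<and> (\<forall>c\<in>set cs'. (\<Sum>i\<in>I. c i * w i) = 0)"
      by (rule Suc.hyps(1)) (use Suc.hyps(2) Suc.prems cs in simp_all)
    then obtain w where "\<exists>i\<in>I. w i \<noteq> 0" "\<forall>d\<in>set cs'. (\<Sum>i\<in>I. d i * w i) = 0" by blast
    moreover have "(\<Sum>i\<in>I. c i * w i) = 0" using True by simp
    ultimately show ?thesis using cs by (intro exI[of _ w]) simp
  next
    case False
    then obtain p where p: "p \<in> I" "c p \<noteq> 0" by blast
    \<comment> \<open>Gaussian elimination: solve the equation \<open>c\<close> for the unknown at \<open>p\<close> and substitute into the others.\<close>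
    define elim where "elim d i = d i - d p / c p * c i" for d i
    have "\<exists>w. (\<exists>i\<in>I - {p}. w i \<noteq> 0) \<and> (\<forall>d\<in>set (map elim cs'). (\<Sum>i\<in>I - {p}. d i * w i) = 0)"
      by (rule Suc.hyps(1)) (use Suc.hyps(2) Suc.prems cs p in simp_all)
    then obtain w where w: "\<exists>i\<in>I - {p}. w i \<noteq> 0"
      "\<And>d. d \<in> set cs' \<Longrightarrow> (\<Sum>i\<in>I - {p}. elim d i * w i) = 0" by fastforce
    define s where "s = (\<Sum>i\<in>I - {p}. c i * w i)"
    define w' where "w' = w(p := - s / c p)"
    have sum: "(\<Sum>i\<in>I. d i * w' i) = d p * w' p + (\<Sum>i\<in>I - {p}. d i * w i)" for d
    proof -
      have "(\<Sum>i\<in>I. d i * w' i) = d p * w' p + (\<Sum>i\<in>I - {p}. d i * w' i)"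
        using p Suc.prems(1) by (simp add: sum.remove)
      also have "(\<Sum>i\<in>I - {p}. d i * w' i) = (\<Sum>i\<in>I - {p}. d i * w i)"
        by (intro sum.cong) (auto simp: w'_def)
      finally show ?thesis .
    qed
    have "(\<Sum>i\<in>I. c i * w' i) = 0"
      unfolding sum using p by (simp add: w'_def s_def)
    moreover have "(\<Sum>i\<in>I. d i * w' i) = 0" if "d \<in> set cs'" for d
    proof -
      have "0 = (\<Sum>i\<in>I - {p}. d i * w i) - d p / c p * s"
        using w(2)[OF that]
        by (simp add: elim_def s_def left_diff_distrib sum_subtractf sum_distrib_left mult.assoc)
      then show ?thesis unfolding sum by (simp add: w'_def)
    qed
    moreover have "\<exists>i\<in>I. w' i \<noteq> 0" using w(1) by (auto simp: w'_def)
    ultimately show ?thesis unfolding cs by (intro exI[of _ w']) (simp add: Ball_def)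
  qed
qed

text \<open>
  Lower bound for the length. Every reflection imposes one linear equation on the odd functions
  on \<open>{\<plusminus>1, \<dots>, \<plusminus>N}\<close>, a space of dimension \<open>N\<close>. A product of fewer than \<open>N\<close> reflections therefore
  leaves a non-zero odd function invariant.
\<close>

lemma short_word_invariant_function:
  assumes "word_for N \<tau> ts" "length ts < N"
  shows "\<exists>v :: int \<Rightarrow> real. (\<forall>x. v (- x) = - v x) \<and> (\<exists>x\<in>signed N. v x \<noteq> 0) \<and> (\<forall>x. v (\<tau> x) = v x)"
proof -
  have "\<forall>t\<in>set ts. \<exists>x y. t = reflection x y \<and> x \<in> signed N \<and> y \<in> signed N"
    using assms(1) unfolding word_for_def generators_eq by blast
  then obtain X Y where XY: "\<And>t. t \<in> set ts \<Longrightarrow> t = reflection (X t) (Y t) \<and> X t \<in> signed N \<and> Y t \<in> signed N"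
    by metis
  define e :: "int \<Rightarrow> int \<Rightarrow> real" where "e x i = (if \<bar>x\<bar> = i then sgn (of_int x) else 0)" for x i
  have "\<exists>w. (\<exists>i\<in>{1..int N}. w i \<noteq> 0) \<and>
      (\<forall>c\<in>set (map (\<lambda>t i. e (X t) i - e (Y t) i) ts). (\<Sum>i\<in>{1..int N}. c i * w i) = 0)"
    by (rule homogeneous_system_nontrivial) (use assms in auto)
  then obtain w where w: "\<exists>i\<in>{1..int N}. w i \<noteq> 0"
    "\<And>t. t \<in> set ts \<Longrightarrow> (\<Sum>i\<in>{1..int N}. (e (X t) i - e (Y t) i) * w i) = 0" by auto
  define v where "v x = sgn (of_int x) * w \<bar>x\<bar>" for x
  have odd: "v (- x) = - v x" for x by (simp add: v_def sgn_minus)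
  have sum_e: "(\<Sum>i\<in>{1..int N}. e x i * w i) = v x" if "x \<in> signed N" for x
  proof -
    have "(\<Sum>i\<in>{1..int N}. e x i * w i) = (\<Sum>i\<in>{1..int N}. if i = \<bar>x\<bar> then v x else 0)"
      by (intro sum.cong) (auto simp: e_def v_def)
    also have "\<dots> = v x" using that by (simp add: signed_def)
    finally show ?thesis .
  qed
  have eq: "v (X t) = v (Y t)" if "t \<in> set ts" for t
    using w(2)[OF that] sum_e XY[OF that] by (simp add: left_diff_distrib sum_subtractf)
  have "v (t z) = v z" if "t \<in> set ts" for t z
    by (subst XY[THEN conjunct1, OF that]) (auto simp: reflection_def eq[OF that] odd)
  then have "v (foldr (\<circ>) ts id z) = v z" for z
    by (induction ts) auto
  moreover have "\<exists>x\<in>signed N. v x \<noteq> 0"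
  proof -
    obtain i where "i \<in> {1..int N}" "w i \<noteq> 0" using w(1) by blast
    then show ?thesis by (intro bexI[of _ i]) (auto simp: v_def signed_def)
  qed
  ultimately show ?thesis
    using odd assms(1) by (intro exI[of _ v]) (auto simp: word_for_def)
qed

section \<open>The permutation \<open>\<gamma>\<close> and its divisors\<close>

lemma cycle_of_list_nth:
  assumes "distinct xs" "k < length xs"
  shows "cycle_of_list xs (xs ! k) = xs ! (Suc k mod length xs)"
proof -
  have "map (cycle_of_list xs) xs = rotate1 xs"
    using cyclic_rotation[OF assms(1), of 1] by simp
  then have "map (cycle_of_list xs) xs ! k = rotate1 xs ! k" by simp
  then show ?thesis using assms(2) by (simp add: nth_rotate1)
qed

text \<open>
  The inner circle carries only the two points \<open>\<plusminus>(p + 1)\<close>.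
\<close>

definition gam :: "nat \<Rightarrow> int \<Rightarrow> int" where
  "gam p = gamma_B p 1"

lemma gam_apply:
  assumes "1 \<le> p"
  shows "gam p x =
    (if 1 \<le> x \<and> x < int p then x + 1
     else if x = int p then - 1
     else if - int p < x \<and> x \<le> - 1 then x - 1
     else if x = - int p then 1
     else if \<bar>x\<bar> = int p + 1 then - x else x)"
proof -
  define xs where "xs = [1..int p]"
  define zs where "zs = xs @ map uminus xs"
  have len: "length zs = 2 * p" by (simp add: zs_def xs_def)
  have nth1: "zs ! k = int k + 1" if "k < p" for k
    using that by (simp add: zs_def xs_def nth_append)
  have nth2: "zs ! (p + k) = - (int k + 1)" if "k < p" for k
    using that by (simp add: zs_def xs_def nth_append)
  have dist: "distinct zs"
    by (auto simp: zs_def xs_def distinct_map inj_on_def)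
  have set: "set zs = signed p"
    by (force simp: zs_def xs_def signed_def image_iff)
  have g: "gam p = cycle_of_list zs \<circ> Transposition.transpose (int p + 1) (- (int p + 1))"
    by (simp add: gam_def gamma_B_def zs_def xs_def Let_def add.commute)
  consider (a) "1 \<le> x" "x < int p" | (b) "x = int p" | (c) "- int p < x" "x \<le> - 1"
    | (d) "x = - int p" | (e) "\<bar>x\<bar> = int p + 1" | (f) "x = 0 \<or> \<bar>x\<bar> > int p + 1"
    by linarith
  then show ?thesis
  proof cases
    case a
    define k where "k = nat (x - 1)"
    have k: "k < p" "Suc k < p" "int k + 1 = x" using a by (auto simp: k_def)
    have "cycle_of_list zs x = x + 1"
      using cycle_of_list_nth[OF dist, of k] nth1[of k] nth1[of "Suc k"] k len by simp
    with a show ?thesis by (simp add: g Transposition.transpose_def)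
  next
    case b
    have "cycle_of_list zs x = - 1"
      using cycle_of_list_nth[OF dist, of "p - 1"] nth1[of "p - 1"] nth2[of 0] b len assms by simp
    with b show ?thesis using assms by (simp add: g Transposition.transpose_def)
  next
    case c
    define k where "k = nat (- x - 1)"
    have k: "k < p" "Suc k < p" "x = - (int k + 1)" using c by (auto simp: k_def)
    have "cycle_of_list zs x = x - 1"
      using cycle_of_list_nth[OF dist, of "p + k"] nth2[of k] nth2[of "Suc k"] k len by simp
    with c show ?thesis by (simp add: g Transposition.transpose_def)
  next
    case d
    have "cycle_of_list zs x = 1"
      using cycle_of_list_nth[OF dist, of "p + (p - 1)"] nth2[of "p - 1"] nth1[of 0] d len assms
      by (simp add: mult_2)
    with d show ?thesis using assms by (simp add: g Transposition.transpose_def)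
  next
    case e
    then have "- x \<notin> set zs" by (auto simp: set signed_def)
    then have "cycle_of_list zs (- x) = - x" by (rule id_outside_supp)
    moreover have "Transposition.transpose (int p + 1) (- (int p + 1)) x = - x"
      using e by (auto simp: Transposition.transpose_def)
    ultimately show ?thesis using e by (auto simp: g)
  next
    case f
    then have "x \<notin> set zs" by (auto simp: set signed_def)
    then have "cycle_of_list zs x = x" by (rule id_outside_supp)
    moreover have "Transposition.transpose (int p + 1) (- (int p + 1)) x = x"
      using f by (auto simp: Transposition.transpose_def)
    ultimately show ?thesis using f assms by (auto simp: g)
  qed
qed

lemma gam_hyper:
  assumes "1 \<le> p" shows "gam p \<in> hyperoctahedral (Suc p)"
proof (rule hyperI)
  have sub: "set ([1..int p] @ map uminus [1..int p]) \<subseteq> signed (Suc p)"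
    "set ([int p + 1..int (p + 1)] @ map uminus [int p + 1..int (p + 1)]) \<subseteq> signed (Suc p)"
    by (auto simp: signed_def)
  show "gam p permutes signed (Suc p)"
    unfolding gam_def gamma_B_def Let_def
    by (intro permutes_compose permutes_subset[OF cycle_permutes] sub)
  show "gam p (- x) = - gam p x" for x
    unfolding gam_apply[OF assms] using assms by auto
qed

text \<open>
  An odd function that is constant on an inversion-invariant cycle vanishes on it, and both cycles
  of \<open>\<gamma>\<close> are inversion-invariant.
\<close>

lemma gam_word_length:
  assumes p: "1 \<le> p" and w: "word_for (Suc p) (gam p) ts"
  shows "Suc p \<le> length ts"
proof (rule ccontr)
  assume "\<not> ?thesis"
  then obtain v :: "int \<Rightarrow> real" where odd: "\<And>x. v (- x) = - v x"
    and nz: "\<exists>x\<in>signed (Suc p). v x \<noteq> 0" and inv: "\<And>x. v (gam p x) = v x"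
    using short_word_invariant_function[OF w] by auto
  have up: "1 \<le> int k \<Longrightarrow> int k \<le> int p \<Longrightarrow> v (int k) = v 1" for k
  proof (induction k)
    case (Suc k)
    show ?case
    proof (cases "k = 0")
      case False
      then have "v (int k + 1) = v (int k)"
        using inv[of "int k"] Suc.prems by (simp add: gam_apply[OF p])
      with Suc False show ?thesis by (simp add: add.commute)
    qed simp
  qed simp
  have "v (int p) = v (- 1)" using inv[of "int p"] p by (simp add: gam_apply[OF p])
  then have "v 1 = 0" using odd[of 1] up[of p] p by simp
  moreover have "v (int p + 1) = 0"
    using inv[of "int p + 1"] odd[of "int p + 1"] by (simp add: gam_apply[OF p])
  ultimately have pos: "v x = 0" if "1 \<le> x" "x \<le> int p + 1" for x
    using up[of "nat x"] that by (cases "x = int p + 1") auto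
  have "v x = 0" if "x \<in> signed (Suc p)" for x
    using that pos[of x] pos[of "- x"] odd[of x] by (cases "x > 0") (auto simp: signed_def)
  with nz show False by blast
qed

text \<open>
  Since \<open>\<gamma>\<close> has length at least \<open>p + 1\<close>, any factorisation of \<open>\<gamma>\<close> into two words of total length
  \<open>p + 1\<close> consists of two shortest words, so the first factor lies below \<open>\<gamma>\<close>.
\<close>

lemma prefix_in_S_nc:
  assumes "1 \<le> p" and \<tau>: "word_for (Suc p) \<tau> ts" and \<rho>: "word_for (Suc p) \<rho> us"
    and eq: "\<tau> \<circ> \<rho> = gam p" and len: "length ts + length us \<le> Suc p"
  shows "\<tau> \<in> S_nc_B p 1"
proof -
  have hyp: "\<tau> \<in> hyperoctahedral (Suc p)" by (rule word_hyper[OF \<tau>])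
  then have "bij \<tau>" by (auto simp: hyperoctahedral_def permutes_bij)
  then have inv: "inv \<tau> \<circ> gam p = \<rho>"
    by (simp add: eq[symmetric] fun_eq_iff bij_is_inj inv_f_f)
  let ?\<gamma> = "gam p"
  obtain ts' where ts': "word_for (Suc p) \<tau> ts'" "length ts' = length_B (Suc p) \<tau>"
    using length_B_attained[OF \<tau>] by blast
  obtain us' where us': "word_for (Suc p) \<rho> us'" "length us' = length_B (Suc p) \<rho>"
    using length_B_attained[OF \<rho>] by blast
  have w: "word_for (Suc p) ?\<gamma> (ts' @ us')"
    using word_for_append[OF ts'(1) us'(1)] eq by simp
  obtain gs where "word_for (Suc p) ?\<gamma> gs" "length gs = length_B (Suc p) ?\<gamma>"
    using length_B_attained[OF w] by blast
  then have "Suc p \<le> length_B (Suc p) ?\<gamma>"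
    using gam_word_length[OF assms(1)] by metis
  moreover have "length_B (Suc p) ?\<gamma> \<le> length_B (Suc p) \<tau> + length_B (Suc p) \<rho>"
    using length_B_le[OF w] ts' us' by simp
  moreover have "length_B (Suc p) \<tau> \<le> length ts" "length_B (Suc p) \<rho> \<le> length us"
    by (rule length_B_le[OF \<tau>], rule length_B_le[OF \<rho>])
  ultimately have "le_B (Suc p) \<tau> ?\<gamma>"
    using len by (simp add: le_B_def inv)
  with hyp show ?thesis by (simp add: S_nc_B_def gam_def)
qed

text \<open>
  The equation \<open>d \<circ> \<gamma> = d \<circ> \<tau>\<close> says that the labelling \<open>d \<circ> \<tau>\<close> is invariant under \<open>\<tau>\<^sup>-\<^sup>1\<gamma>\<close>. It can be
  checked without computing that permutation.
\<close>

lemma complement_word: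
  fixes d :: "int \<Rightarrow> 'a"
  assumes "1 \<le> p" and \<tau>: "\<tau> \<in> hyperoctahedral (Suc p)"
    and d: "\<And>x. x \<in> signed (Suc p) \<Longrightarrow> d (gam p x) = d (\<tau> x)"
    and R: "R \<subseteq> signed (Suc p)" "\<And>x. x \<in> R \<Longrightarrow> - x \<in> R" "inj_on (d \<circ> \<tau>) R"
  shows "\<exists>us. word_for (Suc p) (inv \<tau> \<circ> gam p) us \<and> 2 * length us + card R \<le> 2 * (Suc p)"
proof -
  have perm: "\<tau> permutes signed (Suc p)" and gperm: "gam p permutes signed (Suc p)"
    using \<tau> gam_hyper[OF assms(1)] by (auto simp: hyperoctahedral_def)
  have inv: "\<tau> (inv \<tau> x) = x" for x using perm by (rule permutes_inverses)
  have odd_inv: "inv \<tau> (- x) = - inv \<tau> x" for x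
  proof -
    have "\<tau> (- inv \<tau> x) = - x" by (simp add: hyper_minus[OF \<tau>] inv)
    then show ?thesis using permutes_inverses(2)[OF perm] by metis
  qed
  have "\<exists>us. word_for (Suc p) (inv \<tau> \<circ> gam p) us \<and> 2 * length us \<le> card (signed (Suc p) - R)"
  proof (rule word_from_labels)
    show "inv \<tau> \<circ> gam p permutes signed (Suc p)"
      using perm gperm by (intro permutes_compose permutes_inv)
    show "(inv \<tau> \<circ> gam p) (- x) = - (inv \<tau> \<circ> gam p) x" for x
      by (simp add: hyper_minus[OF gam_hyper[OF assms(1)]] odd_inv)
    show "(d \<circ> \<tau>) ((inv \<tau> \<circ> gam p) x) = (d \<circ> \<tau>) x" if "x \<in> signed (Suc p)" for x
      using d[OF that] by (simp add: inv)
  qed (use R in \<open>simp_all add: comp_def\<close>)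
  moreover have "card (signed (Suc p) - R) = 2 * (Suc p) - card R" "card R \<le> 2 * (Suc p)"
    using R(1) card_signed[of "Suc p"] finite_signed[of "Suc p"]
    by (metis card_Diff_subset finite_subset, metis card_mono)
  ultimately show ?thesis by fastforce
qed

text \<open>
  The position of \<open>x\<close> in the cyclic order \<open>1, \<dots>, p, - 1, \<dots>, - p\<close> of the outer circle, counted from
  1 to \<open>2p\<close>.
\<close>

definition pos :: "nat \<Rightarrow> int \<Rightarrow> int" where
  "pos p x = (if 0 < x then x else int p - x)"

text \<open>
  These are triples whose rotation \<open>(a, b, c)(- a, - b, - c)\<close> lies below \<open>\<gamma>\<close>, normalised by the choice
  of the starting point and of a global sign. Points on the outer circle must lie, in cyclic
  order, within the half circle starting at \<open>a\<close>, so that the triple is separated from its negative;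
  a point \<open>\<plusminus>(p + 1)\<close> on the inner circle may come with either sign.
\<close>

definition annular_triple :: "nat \<Rightarrow> int \<Rightarrow> int \<Rightarrow> int \<Rightarrow> bool" where
  "annular_triple p a b c \<longleftrightarrow>
     0 < a \<and> a \<le> int p \<and> 1 \<le> \<bar>b\<bar> \<and> \<bar>b\<bar> \<le> int p \<and> a < pos p b \<and>
     (\<bar>c\<bar> = int p + 1 \<and> pos p b < a + int p \<or>
      1 \<le> \<bar>c\<bar> \<and> \<bar>c\<bar> \<le> int p \<and> pos p b < pos p c \<and> pos p c < a + int p)"

definition triple_rotation :: "int \<Rightarrow> int \<Rightarrow> int \<Rightarrow> int \<Rightarrow> int" where
  "triple_rotation a b c = reflection a b \<circ> reflection b c"

lemma triple_rotation_apply: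
  assumes "a \<noteq> 0" "b \<noteq> 0" "c \<noteq> 0" "\<bar>a\<bar> \<noteq> \<bar>b\<bar>" "\<bar>b\<bar> \<noteq> \<bar>c\<bar>" "\<bar>a\<bar> \<noteq> \<bar>c\<bar>"
  shows "triple_rotation a b c x =
    (if x = a then b else if x = b then c else if x = c then a
     else if x = - a then - b else if x = - b then - c else if x = - c then - a else x)"
proof -
  have ne: "a \<noteq> b" "b \<noteq> c" "a \<noteq> c" "a \<noteq> - b" "b \<noteq> - c" "a \<noteq> - c" "- a \<noteq> b" "- b \<noteq> c" "- a \<noteq> c"
    "a \<noteq> - a" "b \<noteq> - b" "c \<noteq> - c" "- a \<noteq> a" "- b \<noteq> b" "- c \<noteq> c"
    using assms by auto
  then have ne': "b \<noteq> a" "c \<noteq> b" "c \<noteq> a" "b \<noteq> - a" "c \<noteq> - b" "c \<noteq> - a" "- b \<noteq> a" "- c \<noteq> b" "- c \<noteq> a"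
    by auto
  show ?thesis using assms(1-3) by (simp add: triple_rotation_def reflection_def ne ne')
qed

lemma triple_rotation_cycle:
  assumes "a \<noteq> 0" "b \<noteq> 0" "c \<noteq> 0" "\<bar>a\<bar> \<noteq> \<bar>b\<bar>" "\<bar>b\<bar> \<noteq> \<bar>c\<bar>" "\<bar>a\<bar> \<noteq> \<bar>c\<bar>"
  shows "triple_rotation a b c = triple_rotation b c a"
proof
  fix x
  have ne: "a \<noteq> b" "b \<noteq> c" "a \<noteq> c" "a \<noteq> - b" "b \<noteq> - c" "a \<noteq> - c" "- a \<noteq> b" "- b \<noteq> c" "- a \<noteq> c"
    using assms by auto
  show "triple_rotation a b c x = triple_rotation b c a x"
    unfolding triple_rotation_apply[OF assms]
      triple_rotation_apply[OF assms(2,3,1) assms(5) assms(6)[symmetric] assms(4)[symmetric]]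
    using ne by (cases "x = a"; cases "x = b"; cases "x = c") simp_all
qed

lemma annular_triple_distinct:
  assumes "annular_triple p a b c"
  shows "a \<noteq> 0" "b \<noteq> 0" "c \<noteq> 0" "\<bar>a\<bar> \<noteq> \<bar>b\<bar>" "\<bar>b\<bar> \<noteq> \<bar>c\<bar>" "\<bar>a\<bar> \<noteq> \<bar>c\<bar>"
    "a \<in> signed (Suc p)" "b \<in> signed (Suc p)" "c \<in> signed (Suc p)"
  using assms by (auto simp: annular_triple_def pos_def signed_def split: if_splits)

text \<open>
  The cycles of \<open>\<gamma>\<close> are cut by \<open>a, b, c\<close> and their negatives. Each arc of the outer circle receives
  one label: 1 from \<open>a\<close> to \<open>b\<close>, 2 from \<open>b\<close> to \<open>c\<close> (or, if \<open>c\<close> is on the inner circle, from \<open>b\<close> to \<open>- a\<close>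
  and at \<open>c\<close> itself), the opposite labels on the opposite arcs, and 0 elsewhere. This
  exhibits two opposite pairs of cycles of the complement, hence its length is at most
  \<open>(p + 1) - 2\<close>.
\<close>

lemma annular_triple_complement:
  assumes p: "1 \<le> p" and t: "annular_triple p a b c"
  shows "\<exists>us. word_for (Suc p) (inv (triple_rotation a b c) \<circ> gam p) us \<and> length us + 2 \<le> Suc p"
proof -
  note ne = annular_triple_distinct[OF t]
  let ?\<tau> = "triple_rotation a b c"
  have w: "word_for (Suc p) ?\<tau> [reflection a b, reflection b c]"
    using word_for_Cons[OF word_for_Cons[OF word_for_Nil, of b "Suc p" c], of a b] ne
    by (auto simp: triple_rotation_def)
  then have hyp: "?\<tau> \<in> hyperoctahedral (Suc p)" by (rule word_hyper)
  \<comment> \<open>The second arc ends at \<open>c\<close> or, if \<open>c\<close> is on the inner circle, at \<open>- a\<close>, which has position \<open>a + p\<close>.\<close>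
  define top where "top = (if \<bar>c\<bar> = int p + 1 then a + int p else pos p c)"
  define L :: "int \<Rightarrow> int" where "L x = (if \<bar>x\<bar> \<le> int p then
      if a < pos p x \<and> pos p x \<le> pos p b then 1 else if pos p b < pos p x \<and> pos p x \<le> top then 2 else 0
      else if x = c then 2 else 0)" for x
  define d where "d x = L x - L (- x)" for x
  have odd: "d (- x) = - d x" for x by (simp add: d_def)
  define B C where "B = pos p b" and "C = pos p c"
  have top: "B < top" "top \<le> a + int p" and aB: "0 < a" "a \<le> int p" "a < B"
    using t by (auto simp: annular_triple_def top_def B_def C_def)
  have dx: "d x = (if a < x \<and> x \<le> B then 1 else if B < x \<and> x \<le> top then 2
      else if a < int p + x \<and> int p + x \<le> B then - 1
      else if B < int p + x \<and> int p + x \<le> top then - 2 else 0)" if "1 \<le> x" "x \<le> int p" for x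
    using that top aB by (auto simp: d_def L_def B_def[symmetric] pos_def[of p x] pos_def[of p "- x"])
  have bB: "b = (if B \<le> int p then B else int p - B)" and Bp: "int p + 1 \<le> B \<or> B \<le> int p"
    using t by (auto simp: B_def pos_def annular_triple_def)
  have db: "d b = 1"
    using dx[of "\<bar>b\<bar>"] odd[of "\<bar>b\<bar>"] bB t aB top by (auto simp: annular_triple_def split: if_splits)
  have dn: "d (int p + 1) = (if c = int p + 1 then 2 else if c = - (int p + 1) then - 2 else 0)"
    by (auto simp: d_def L_def)
  have c: "\<bar>c\<bar> = int p + 1 \<and> top = a + int p \<or>
      \<bar>c\<bar> \<le> int p \<and> top = C \<and> C < a + int p \<and> c = (if C \<le> int p then C else int p - C)"
    using t by (auto simp: top_def C_def pos_def annular_triple_def)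
  have dc: "d c = 2"
    using dx[of "\<bar>c\<bar>"] odd[of "\<bar>c\<bar>"] dn odd[of "int p + 1"] c aB top by (auto split: if_splits)
  have da: "d a = (if \<bar>c\<bar> = int p + 1 then - 2 else 0)"
    using dx[of a] aB c top by auto
  have d\<tau>: "d (?\<tau> x) = (if x = a then 1 else if x = B then 2 else if x = B - int p then - 2
      else if \<bar>c\<bar> \<le> int p \<and> (x = C \<or> x = C - int p) then 0 else d x)"
    if x: "1 \<le> x" "x \<le> int p" for x
  proof -
    consider "x = a" | "x = b" | "x = - b" | "x = c" | "x = - c"
      | "x \<noteq> a" "x \<noteq> b" "x \<noteq> - b" "x \<noteq> c" "x \<noteq> - c" by blast
    then show ?thesis
    proof cases
      case 1 then show ?thesis using db by (simp add: triple_rotation_apply[OF ne(1-6)])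
    next
      case 2
      then have "?\<tau> x = c" "x = B" "x \<noteq> a"
        using ne bB x aB by (auto simp: triple_rotation_apply split: if_splits)
      then show ?thesis using dc by simp
    next
      case 3
      then have "?\<tau> x = - c" "x = B - int p" "x \<noteq> a" "x \<noteq> B"
        using ne bB x p aB by (auto simp: triple_rotation_apply split: if_splits)
      then show ?thesis using dc by (simp add: odd)
    next
      case 4
      then have "?\<tau> x = a" "x = C" "x \<noteq> a" "x \<noteq> b" "x \<noteq> - b" "\<bar>c\<bar> \<le> int p"
        using ne c x aB top by (auto simp: triple_rotation_apply split: if_splits)
      then show ?thesis using da bB Bp x by (auto split: if_splits)
    next
      case 5
      then have "?\<tau> x = - a" "x = C - int p" "x \<noteq> a" "x \<noteq> b" "x \<noteq> - b" "\<bar>c\<bar> \<le> int p"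
        using ne c x aB top by (auto simp: triple_rotation_apply split: if_splits)
      then show ?thesis using da odd[of a] bB Bp x by (auto split: if_splits)
    next
      case 6
      moreover have "x \<noteq> - a" using x aB by auto
      ultimately have t: "?\<tau> x = x" by (simp add: triple_rotation_apply[OF ne(1-6)])
      have "x \<noteq> B" "x \<noteq> B - int p" using 6 x bB Bp by auto
      moreover have C: "\<not> (\<bar>c\<bar> \<le> int p \<and> (x = C \<or> x = C - int p))" using 6 x c by auto
      ultimately show ?thesis using 6(1) unfolding t if_not_P[OF C] by simp
    qed
  qed
  have d0: "d (gam p x) = d (?\<tau> x)" if x: "1 \<le> x" "x \<le> int p + 1" for x
  proof -
    consider "x < int p" | "x = int p" | "x = int p + 1" using x by linarith
    then show ?thesis
    proof cases
      case 1
      then have "gam p x = x + 1" using x by (simp add: gam_apply[OF p])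
      moreover have "d (x + 1) = d (?\<tau> x)"
        using 1 x dx[of x] dx[of "x + 1"] d\<tau>[of x] aB top c by auto
      ultimately show ?thesis by simp
    next
      case 2
      then have "gam p x = - 1" by (simp add: gam_apply[OF p])
      moreover have "d (- 1) = d (?\<tau> x)"
        using 2 x p odd[of 1] dx[of x] dx[of 1] d\<tau>[of x] aB top c by auto
      ultimately show ?thesis by simp
    next
      case 3
      then have "gam p x = - (int p + 1)" by (simp add: gam_apply[OF p])
      moreover have "d (?\<tau> x) = - d (int p + 1)"
      proof -
        have xne: "x \<noteq> a" "x \<noteq> - a" "x \<noteq> b" "x \<noteq> - b"
          using 3 t by (auto simp: annular_triple_def)
        consider (pl) "c = int p + 1" | (mi) "c = - (int p + 1)" | (inn) "\<bar>c\<bar> \<le> int p" using c by linarith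
        then show ?thesis
        proof cases
          case pl
          then have "?\<tau> x = a" using 3 ne xne by (simp add: triple_rotation_apply)
          then show ?thesis using pl 3 dn da by simp
        next
          case mi
          then have "x = - c" "x \<noteq> c" using 3 by auto
          then have "?\<tau> x = - a"
            using ne xne by (simp add: triple_rotation_apply)
          then show ?thesis using mi dn da odd[of a] by simp
        next
          case inn
          then have "x \<noteq> c" "x \<noteq> - c" using \<open>x = int p + 1\<close> by auto
          then have "?\<tau> x = x"
            using ne xne by (simp add: triple_rotation_apply)
          moreover have "d (int p + 1) = 0" using inn dn by auto
          ultimately show ?thesis using \<open>x = int p + 1\<close> by simp
        qed
      qed
      ultimately show ?thesis using odd[of "int p + 1"] by simp
    qed
  qed
  have d: "d (gam p x) = d (?\<tau> x)" if "x \<in> signed (Suc p)" for x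
    using d0[of x] d0[of "- x"] odd that
    by (cases "0 < x") (auto simp: signed_def hyper_minus[OF hyp] hyper_minus[OF gam_hyper[OF p]])
  define R where "R = {a, b, - a, - b}"
  have ta: "?\<tau> a = b" and tb: "?\<tau> b = c"
    using ne by (auto simp: triple_rotation_apply)
  have inj: "inj_on (d \<circ> ?\<tau>) R"
    by (auto simp: R_def inj_on_def ta tb hyper_minus[OF hyp] db dc odd)
  have "card R = 4" using ne by (auto simp: R_def card_insert_if)
  moreover have "R \<subseteq> signed (Suc p)" "\<And>x. x \<in> R \<Longrightarrow> - x \<in> R"
    using ne(7,8) by (auto simp: R_def)
  ultimately show ?thesis
    using complement_word[OF p hyp d _ _ inj] by fastforce
qed

text \<open>
  A rotation of three points is a product of two reflections in three ways, and each of the three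
  reflections occurs as a first factor. One word for the complement thus yields words of length
  \<open>p + 1\<close> for \<open>\<gamma>\<close> that begin with any of them.
\<close>

lemma annular_triple_divisors:
  assumes p: "1 \<le> p" and t: "annular_triple p a b c"
  shows "triple_rotation a b c \<in> S_nc_B p 1" "reflection a b \<in> S_nc_B p 1" "reflection b c \<in> S_nc_B p 1"
    "reflection c a \<in> S_nc_B p 1" "id \<in> S_nc_B p 1"
proof -
  note ne = annular_triple_distinct[OF t]
  let ?\<tau> = "triple_rotation a b c"
  obtain us where us: "word_for (Suc p) (inv ?\<tau> \<circ> gam p) us" "length us + 2 \<le> Suc p"
    using annular_triple_complement[OF assms] by blast
  have gen: "word_for (Suc p) (reflection x y) [reflection x y]"
    if "x \<in> signed (Suc p)" "y \<in> signed (Suc p)" "x \<noteq> y" for x y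
    using word_for_Cons[OF word_for_Nil that] by simp
  have ab: "word_for (Suc p) (reflection a b) [reflection a b]" and bc: "word_for (Suc p) (reflection b c) [reflection b c]"
    and ca: "word_for (Suc p) (reflection c a) [reflection c a]"
    using ne by (metis gen)+
  have "bij ?\<tau>"
    using word_hyper[OF word_for_append[OF ab bc]]
    by (auto simp: hyperoctahedral_def triple_rotation_def permutes_bij)
  then have g: "?\<tau> \<circ> (inv ?\<tau> \<circ> gam p) = gam p"
    by (simp add: o_assoc surj_iff[THEN iffD1] bij_is_surj)
  have rot: "?\<tau> = reflection b c \<circ> reflection c a" "?\<tau> = reflection c a \<circ> reflection a b"
    using triple_rotation_cycle[OF ne(1-6)] triple_rotation_cycle[of b c a] ne
    by (simp_all add: triple_rotation_def)
  have "word_for (Suc p) ?\<tau> ([reflection a b] @ [reflection b c])"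
    using word_for_append[OF ab bc] by (simp add: triple_rotation_def)
  from prefix_in_S_nc[OF p this us(1) g] us(2) show "?\<tau> \<in> S_nc_B p 1" by simp
  have step: "reflection x y \<in> S_nc_B p 1"
    if xy: "word_for (Suc p) (reflection x y) [reflection x y]" and yz: "word_for (Suc p) (reflection y z) [reflection y z]"
      and eq: "?\<tau> = reflection x y \<circ> reflection y z" for x y z
    by (rule prefix_in_S_nc[OF p xy word_for_append[OF yz us(1)]])
      (use g us(2) eq in \<open>simp_all add: o_assoc\<close>)
  show "reflection a b \<in> S_nc_B p 1" by (rule step[OF ab bc]) (simp add: triple_rotation_def)
  show "reflection b c \<in> S_nc_B p 1" by (rule step[OF bc ca rot(1)])
  show "reflection c a \<in> S_nc_B p 1" by (rule step[OF ca ab rot(2)])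
  show "id \<in> S_nc_B p 1"
    by (rule prefix_in_S_nc[OF p word_for_Nil
          word_for_append[OF word_for_append[OF ab bc] us(1)]])
      (use g us(2) in \<open>simp_all add: triple_rotation_def\<close>)
qed

section \<open>Symmetric partitions and their large blocks\<close>

definition sym_partition :: "nat \<Rightarrow> int set set \<Rightarrow> bool" where
  "sym_partition n P \<longleftrightarrow> partition_on (signed n) P \<and> (\<forall>A\<in>P. uminus ` A \<in> P)"

text \<open>
  A symmetric partition is determined by its blocks with at least two elements. These
  families of blocks describe partitions below: \<open>with_blocks\<close> and \<open>large_blocks\<close> are inverse to each
  other.
\<close>

definition block_family :: "nat \<Rightarrow> int set set \<Rightarrow> bool" where
  "block_family n F \<longleftrightarrow> \<Union>F \<subseteq> signed n \<and> disjoint F \<and> (\<forall>A\<in>F. 2 \<le> card A \<and> uminus ` A \<in> F)"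

definition with_blocks :: "nat \<Rightarrow> int set set \<Rightarrow> int set set" where
  "with_blocks n F = F \<union> (\<lambda>z. {z}) ` (signed n - \<Union>F)"

definition large_blocks :: "int set set \<Rightarrow> int set set" where
  "large_blocks P = {A \<in> P. 2 \<le> card A}"

definition down :: "nat \<Rightarrow> int set set set \<Rightarrow> int set set \<Rightarrow> int set set set" where
  "down n X P = {Q \<in> X. refines (signed n) Q P}"

lemma uminus_image_uminus_image [simp]: "uminus ` uminus ` A = (A :: int set)"
  by (simp add: image_image)

lemma card_uminus_image [simp]: "card (uminus ` A) = card (A :: int set)"
  by (simp add: card_image)

lemma uminus_image_Union: "(\<And>A. A \<in> F \<Longrightarrow> uminus ` A \<in> F) \<Longrightarrow> x \<in> \<Union>F \<Longrightarrow> - (x :: int) \<in> \<Union>F"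
  by blast

lemma sym_partition_with_blocks:
  assumes "block_family n F" shows "sym_partition n (with_blocks n F)"
  unfolding sym_partition_def partition_on_def
proof (intro conjI ballI)
  have F: "\<Union>F \<subseteq> signed n" "disjoint F" "\<And>A. A \<in> F \<Longrightarrow> 2 \<le> card A" "\<And>A. A \<in> F \<Longrightarrow> uminus ` A \<in> F"
    using assms by (auto simp: block_family_def)
  show "\<Union>(with_blocks n F) = signed n" using F(1) by (auto simp: with_blocks_def)
  show "disjoint (with_blocks n F)"
    using F(2) by (auto simp: with_blocks_def disjoint_def)
  show "{} \<notin> with_blocks n F" using F(3) by (force simp: with_blocks_def)
  fix A assume "A \<in> with_blocks n F"
  then consider "A \<in> F" | z where "z \<in> signed n - \<Union>F" "A = {z}" by (auto simp: with_blocks_def)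
  then show "uminus ` A \<in> with_blocks n F"
  proof cases
    case 2
    then have "- z \<in> signed n - \<Union>F" using uminus_image_Union[of F "- z"] F(4) by auto
    with 2 show ?thesis by (auto simp: with_blocks_def)
  qed (use F(4) in \<open>auto simp: with_blocks_def\<close>)
qed

lemma large_blocks_with_blocks: "block_family n F \<Longrightarrow> large_blocks (with_blocks n F) = F"
  by (auto simp: large_blocks_def with_blocks_def block_family_def)

lemma inj_on_with_blocks: "inj_on (with_blocks n) {F. block_family n F}"
  by (rule inj_on_inverseI[of _ large_blocks]) (simp add: large_blocks_with_blocks)

lemma sym_partition_eq_with_blocks:
  assumes "sym_partition n P"
  shows "block_family n (large_blocks P)" "P = with_blocks n (large_blocks P)"
proof -
  have P: "\<Union>P = signed n" "disjoint P" "{} \<notin> P" "\<And>A. A \<in> P \<Longrightarrow> uminus ` A \<in> P"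
    using assms by (auto simp: sym_partition_def partition_on_def)
  show bf: "block_family n (large_blocks P)"
    using P unfolding block_family_def large_blocks_def
    by (auto simp: disjoint_def)
  have sing: "\<exists>z. A = {z}" if "A \<in> P" "\<not> 2 \<le> card A" for A
  proof -
    have "finite A" using P(1) that(1) finite_signed by (metis Union_upper finite_subset)
    moreover have "A \<noteq> {}" using P(3) that(1) by blast
    ultimately have "card A = 1" using that(2) by (simp add: Suc_leI card_gt_0_iff le_antisym not_le less_Suc_eq_le numeral_2_eq_2)
    then show ?thesis by (rule card_1_singletonE) blast
  qed
  show "P = with_blocks n (large_blocks P)"
  proof (intro set_eqI iffI)
    fix A assume A: "A \<in> P"
    show "A \<in> with_blocks n (large_blocks P)"
    proof (cases "2 \<le> card A")
      case False
      then obtain z where z: "A = {z}" using sing A by blast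
      have "z \<notin> \<Union>(large_blocks P)"
      proof
        assume "z \<in> \<Union>(large_blocks P)"
        then obtain B where "B \<in> P" "z \<in> B" and B2: "2 \<le> card B" by (auto simp: large_blocks_def)
        moreover have "B \<noteq> A" using z B2 by auto
        ultimately show False using disjointD[OF P(2) A \<open>B \<in> P\<close>] z \<open>z \<in> B\<close> by blast
      qed
      moreover have "z \<in> signed n" using A z P(1) by blast
      ultimately show ?thesis using z by (auto simp: with_blocks_def)
    qed (use A in \<open>auto simp: with_blocks_def large_blocks_def\<close>)
  next
    fix A assume "A \<in> with_blocks n (large_blocks P)"
    then consider "A \<in> large_blocks P" | z where "z \<in> signed n" "z \<notin> \<Union>(large_blocks P)" "A = {z}"
      by (auto simp: with_blocks_def)
    then show "A \<in> P"
    proof cases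
      case 2
      then obtain B where "B \<in> P" "z \<in> B" using P(1) by blast
      with 2 sing[of B] show ?thesis by (force simp: large_blocks_def)
    qed (simp add: large_blocks_def)
  qed
qed

lemma refines_with_blocks:
  assumes "block_family n F" "partition_on (signed n) P" "\<And>A. A \<in> F \<Longrightarrow> \<exists>B\<in>P. A \<subseteq> B"
  shows "refines (signed n) (with_blocks n F) P"
  unfolding refines_def
proof (intro conjI ballI)
  show "partition_on (signed n) (with_blocks n F)"
    using sym_partition_with_blocks[OF assms(1)] by (simp add: sym_partition_def)
  fix X assume "X \<in> with_blocks n F"
  then consider "X \<in> F" | z where "z \<in> signed n" "X = {z}" by (auto simp: with_blocks_def)
  then show "\<exists>Y\<in>P. X \<subseteq> Y"
  proof cases
    case 2
    then show ?thesis using partition_onD1[OF assms(2)] by auto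
  qed (use assms(3) in blast)
qed (rule assms(2))

lemma block_family_pair:
  assumes "A \<subseteq> signed n" "2 \<le> card A" "A \<inter> uminus ` A = {} \<or> uminus ` A = A"
  shows "block_family n {A, uminus ` A}"
  using assms by (auto simp: block_family_def disjoint_def)

lemma block_family_doubleton:
  assumes "x \<in> signed n" "y \<in> signed n" "x \<noteq> y"
  shows "block_family n {{x, y}, uminus ` {x, y}}"
proof (rule block_family_pair)
  have "x \<noteq> 0" "y \<noteq> 0" using assms by (auto simp: signed_def)
  with assms show "{x, y} \<inter> uminus ` {x, y} = {} \<or> uminus ` {x, y} = {x, y}"
    by (cases "y = - x") auto
qed (use assms in auto)

lemma finite_sym_partitions: "finite {P. sym_partition n P}"
  by (rule finite_subset[of _ "Pow (Pow (signed n))"]) (auto simp: sym_partition_def partition_on_def)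

text \<open>
  A symmetric partition that refines the one with blocks \<open>T\<close>, \<open>- T\<close> and singletons is a partition of
  \<open>T\<close>, copied to \<open>- T\<close>. A set of three elements has five partitions.
\<close>

lemma down_three_blocks:
  assumes T: "T \<subseteq> signed n" "card T = 3" "T \<inter> uminus ` T = {}"
    and X: "\<And>P. P \<in> X \<Longrightarrow> sym_partition n P"
    and mem: "with_blocks n {} \<in> X"
      "\<And>B. B \<subseteq> T \<Longrightarrow> 2 \<le> card B \<Longrightarrow> with_blocks n {B, uminus ` B} \<in> X"
  shows "card (down n X (with_blocks n {T, uminus ` T})) = 5"
proof -
  define \<B> where "\<B> = {B. B \<subseteq> T \<and> 2 \<le> card B}"
  define \<F> where "\<F> = insert {} ((\<lambda>B. {B, uminus ` B}) ` \<B>)"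
  have finT: "finite T" using T(2) by (simp add: card_ge_0_finite)
  have dis: "B \<inter> uminus ` B = {}" if "B \<subseteq> T" for B using that T(3) by blast
  have bf: "block_family n F" if "F \<in> \<F>" for F
    using that T dis block_family_pair by (auto simp: \<F>_def \<B>_def) (auto simp: block_family_def)
  have bfT: "block_family n {T, uminus ` T}"
    using T by (intro block_family_pair) auto
  have "down n X (with_blocks n {T, uminus ` T}) = with_blocks n ` \<F>"
  proof (intro set_eqI iffI)
    fix P assume P: "P \<in> down n X (with_blocks n {T, uminus ` T})"
    then have sp: "sym_partition n P" and ref: "refines (signed n) P (with_blocks n {T, uminus ` T})"
      using X by (auto simp: down_def)
    define F where "F = large_blocks P"
    have F: "block_family n F" "P = with_blocks n F"
      using sym_partition_eq_with_blocks[OF sp] by (auto simp: F_def)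
    have sub: "B \<subseteq> T \<or> uminus ` B \<subseteq> T" if "B \<in> F" for B
    proof -
      have B: "B \<in> P" "2 \<le> card B" using that by (auto simp: F_def large_blocks_def)
      then obtain C where C: "C \<in> with_blocks n {T, uminus ` T}" "B \<subseteq> C"
        using ref by (auto simp: refines_def)
      have "C \<noteq> {z}" for z using B(2) C(2) by (metis card_mono finite.emptyI finite_insert is_singletonI is_singleton_altdef not_less_eq_eq numeral_2_eq_2 order_trans One_nat_def)
      then have "C = T \<or> C = uminus ` T" using C(1) by (auto simp: with_blocks_def)
      then show ?thesis using C(2) image_mono[of B C uminus] by auto
    qed
    have "F \<in> \<F>"
    proof (cases "F = {}")
      case False
      then obtain B where B: "B \<in> F" "B \<subseteq> T"
        using sub F(1) by (metis (no_types, lifting) block_family_def equals0I)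
      have card2: "2 \<le> card B" "uminus ` B \<in> F" using B F(1) by (auto simp: block_family_def)
      have uniq: "C = B" if C: "C \<in> F" "C \<subseteq> T" for C
      proof (rule ccontr)
        assume "C \<noteq> B"
        then have "C \<inter> B = {}" using C(1) B(1) F(1) by (auto simp: block_family_def disjoint_def)
        moreover have "2 \<le> card C" using C F(1) by (auto simp: block_family_def)
        ultimately have "4 \<le> card (C \<union> B)"
          using card2 finT B(2) C(2) by (subst card_Un_disjoint) (auto intro: finite_subset)
        moreover have "card (C \<union> B) \<le> 3" using T(2) finT B(2) C(2) by (metis Un_least card_mono)
        ultimately show False by simp
      qed
      have "F = {B, uminus ` B}"
      proof (intro set_eqI iffI)
        fix C assume C: "C \<in> F"
        then have "uminus ` C \<in> F" using F(1) by (auto simp: block_family_def)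
        then have "C = B \<or> uminus ` C = B" using uniq[OF C] uniq[of "uminus ` C"] sub[OF C] by metis
        then show "C \<in> {B, uminus ` B}" by auto
      qed (use B card2 in auto)
      then show ?thesis using B card2 by (auto simp: \<F>_def \<B>_def)
    qed (simp add: \<F>_def)
    then show "P \<in> with_blocks n ` \<F>" using F by blast
  next
    fix P assume "P \<in> with_blocks n ` \<F>"
    then obtain F where F: "F \<in> \<F>" "P = with_blocks n F" by blast
    have "P \<in> X" using F mem by (auto simp: \<F>_def \<B>_def)
    moreover have "refines (signed n) P (with_blocks n {T, uminus ` T})"
      unfolding F(2)
    proof (rule refines_with_blocks[OF bf[OF F(1)]])
      show "partition_on (signed n) (with_blocks n {T, uminus ` T})"
        using sym_partition_with_blocks[OF bfT] by (simp add: sym_partition_def)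
      show "\<exists>B\<in>with_blocks n {T, uminus ` T}. A \<subseteq> B" if "A \<in> F" for A
      proof -
        have "F \<noteq> {}" using that by blast
        then obtain C where C: "C \<subseteq> T" "F = {C, uminus ` C}"
          using F(1) unfolding \<F>_def \<B>_def by blast
        have "T \<in> with_blocks n {T, uminus ` T}" "uminus ` T \<in> with_blocks n {T, uminus ` T}"
          by (simp_all add: with_blocks_def)
        moreover have "A = C \<or> A = uminus ` C" using that C(2) by blast
        ultimately show ?thesis using C(1) image_mono[of C T uminus] by blast
      qed
    qed
    ultimately show "P \<in> down n X (with_blocks n {T, uminus ` T})" by (simp add: down_def)
  qed
  moreover have "card (with_blocks n ` \<F>) = card \<F>"
    by (rule card_image, rule inj_on_subset[OF inj_on_with_blocks]) (use bf in auto)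
  moreover have "card \<F> = Suc (card \<B>)"
  proof -
    have "inj_on (\<lambda>B. {B, uminus ` B}) \<B>"
    proof (rule inj_onI)
      fix B C assume B: "B \<in> \<B>" and C: "C \<in> \<B>" and eq: "{B, uminus ` B} = {C, uminus ` C}"
      have "C \<noteq> {}" using C by (auto simp: \<B>_def)
      moreover have "uminus ` B \<inter> T = {}" using B T(3) by (auto simp: \<B>_def)
      ultimately have "C \<noteq> uminus ` B" using C by (auto simp: \<B>_def)
      then show "B = C" using eq by (metis insertI1 insertE singletonD)
    qed
    moreover have "finite \<B>" using finT by (simp add: \<B>_def)
    ultimately show ?thesis unfolding \<F>_def by (subst card_insert_disjoint) (auto simp: card_image)
  qed
  moreover have "card \<B> = 4"
  proof -
    have "\<B> = {B. B \<subseteq> T \<and> card B = 2} \<union> {T}"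
    proof (intro set_eqI iffI)
      fix B assume B: "B \<in> \<B>"
      then have B': "B \<subseteq> T" "2 \<le> card B" by (auto simp: \<B>_def)
      moreover have "card B \<le> 3" using card_mono[OF finT B'(1)] T(2) by simp
      ultimately show "B \<in> {B. B \<subseteq> T \<and> card B = 2} \<union> {T}"
        using card_subset_eq[OF finT, of B] T(2) by (cases "card B = 2") auto
    qed (use T(2) in \<open>auto simp: \<B>_def\<close>)
    moreover have "card {B. B \<subseteq> T \<and> card B = 2} = 3 choose 2" using n_subsets[OF finT, of 2] T(2) by simp
    moreover have "(3::nat) choose 2 = 3" by (simp add: numeral_eq_Suc)
    moreover have "finite {B. B \<subseteq> T \<and> card B = 2}" using finT by simp
    ultimately show ?thesis using T(2) by simp
  qed
  ultimately show ?thesis by simp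
qed

section \<open>The annular poset\<close>

text \<open>
  The union of the inversion-invariant blocks is again inversion-invariant.
\<close>

lemma merge_sym_partition:
  assumes "sym_partition n P" shows "sym_partition n (merge_invariant_blocks P)"
proof (cases "{A \<in> P. uminus ` A = A} = {}")
  case True
  then show ?thesis using assms by (simp add: merge_invariant_blocks_def Let_def)
next
  case False
  define Z where "Z = {A \<in> P. uminus ` A = A}"
  have P: "\<Union>P = signed n" "disjoint P" "{} \<notin> P" "\<And>A. A \<in> P \<Longrightarrow> uminus ` A \<in> P"
    using assms by (auto simp: sym_partition_def partition_on_def)
  have Z: "Z \<subseteq> P" "Z \<noteq> {}" using False by (auto simp: Z_def)
  have eq: "merge_invariant_blocks P = insert (\<Union>Z) (P - Z)"
    using Z(2) unfolding merge_invariant_blocks_def Let_def Z_def[symmetric] by simp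
  have neg: "uminus ` \<Union>Z = \<Union>Z"
  proof -
    have "uminus ` \<Union>Z = (\<Union>A\<in>Z. uminus ` A)" by blast
    also have "\<dots> = (\<Union>A\<in>Z. A)" by (rule SUP_cong) (auto simp: Z_def)
    finally show ?thesis by simp
  qed
  have disj: "A \<inter> \<Union>Z = {}" if "A \<in> P - Z" for A
    using that P(2) Z(1) by (fastforce simp: disjoint_def)
  show ?thesis
    unfolding sym_partition_def partition_on_def eq
  proof (intro conjI ballI)
    have "\<Union>(insert (\<Union>Z) (P - Z)) = \<Union>Z \<union> \<Union>(P - Z)" by simp
    also have "\<dots> = \<Union>(Z \<union> (P - Z))" by (rule Union_Un_distrib[symmetric])
    also have "Z \<union> (P - Z) = P" using Z(1) by (simp add: Un_absorb1)
    finally show "\<Union>(insert (\<Union>Z) (P - Z)) = signed n" using P(1) by simp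
    show "disjoint (insert (\<Union>Z) (P - Z))"
    proof (rule disjointI)
      fix A B assume "A \<in> insert (\<Union>Z) (P - Z)" "B \<in> insert (\<Union>Z) (P - Z)" "A \<noteq> B"
      then consider "A \<in> P - Z" "B \<in> P - Z" | "A = \<Union>Z" "B \<in> P - Z" | "A \<in> P - Z" "B = \<Union>Z"
        by blast
      then show "A \<inter> B = {}"
      proof cases
        case 1 then show ?thesis using disjointD[OF P(2)] \<open>A \<noteq> B\<close> by blast
      next
        case 2 then show ?thesis using disj[of B] by (simp add: Int_commute)
      next
        case 3 then show ?thesis using disj[of A] by simp
      qed
    qed
    have "\<Union>Z \<noteq> {}" using P(3) Z by fastforce
    then show "{} \<notin> insert (\<Union>Z) (P - Z)" using P(3) by auto
    fix A assume "A \<in> insert (\<Union>Z) (P - Z)"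
    then show "uminus ` A \<in> insert (\<Union>Z) (P - Z)"
    proof
      assume A: "A \<in> P - Z"
      then have "uminus ` A \<notin> Z" using Z_def uminus_image_uminus_image by auto
      then show ?thesis using P(4)[of A] A by simp
    qed (simp add: neg)
  qed
qed

lemma orbit_uminus:
  fixes \<tau> :: "int \<Rightarrow> int"
  assumes "\<And>z. \<tau> (- z) = - \<tau> z" shows "orbit \<tau> (- x) = uminus ` orbit \<tau> x"
proof -
  have sub: "uminus ` orbit \<tau> x \<subseteq> orbit \<tau> (- x)" for x
  proof
    fix y assume "y \<in> uminus ` orbit \<tau> x"
    then obtain z where "z \<in> orbit \<tau> x" "y = - z" by blast
    then show "y \<in> orbit \<tau> (- x)"
      by (induction arbitrary: y) (metis assms orbit.intros)+
  qed
  have "orbit \<tau> (- x) \<subseteq> uminus ` orbit \<tau> x"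
    using image_mono[OF sub[of "- x"], of uminus] by (simp only: uminus_image_uminus_image minus_minus)
  with sub[of x] show ?thesis by blast
qed

lemma orbit_partition_sym:
  assumes "\<tau> \<in> hyperoctahedral n" shows "sym_partition n (orbit_partition n \<tau>)"
proof -
  have perm: "\<tau> permutes signed n" using assms by (simp add: hyperoctahedral_def)
  then have "permutation \<tau>" using finite_signed permutation_permutes by blast
  then have self: "x \<in> orbit \<tau> x" for x by (rule permutation_self_in_orbit)
  have eq: "orbit \<tau> y = orbit \<tau> x" if "y \<in> orbit \<tau> x" for x y
    using orbit_cyclic_eq3[OF cyclic_on_orbit[OF perm finite_signed] that] .
  show ?thesis
    unfolding sym_partition_def partition_on_def orbit_partition_def
  proof (intro conjI ballI)
    show "\<Union>(orbit \<tau> ` signed n) = signed n"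
      using self permutes_orbit_subset[OF perm] by blast
    show "disjoint (orbit \<tau> ` signed n)"
      unfolding disjoint_def using eq by blast
    show "{} \<notin> orbit \<tau> ` signed n" using self by blast
    fix A assume "A \<in> orbit \<tau> ` signed n"
    then obtain x where "x \<in> signed n" "A = orbit \<tau> x" by blast
    then show "uminus ` A \<in> orbit \<tau> ` signed n"
      using orbit_uminus[of \<tau> x] hyper_minus[OF assms] by (metis image_eqI signed_minus)
  qed
qed

lemma annular_sym_partition: "P \<in> NC_B_annular p 1 \<Longrightarrow> sym_partition (Suc p) P"
  by (auto simp: NC_B_annular_def S_nc_B_def intro!: merge_sym_partition orbit_partition_sym)

text \<open>
  When no block is inversion-invariant, nothing is merged. No singleton is inversion-invariant, so
  this only concerns the blocks in \<open>F\<close>.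
\<close>

lemma with_blocks_annular:
  assumes \<tau>: "\<tau> \<in> S_nc_B p 1" and bf: "block_family (Suc p) F"
    and F: "\<And>A. A \<in> F \<Longrightarrow> uminus ` A \<noteq> A" "\<And>A x. A \<in> F \<Longrightarrow> x \<in> A \<Longrightarrow> orbit \<tau> x = A"
      "\<And>x. x \<notin> \<Union>F \<Longrightarrow> \<tau> x = x"
  shows "with_blocks (Suc p) F \<in> NC_B_annular p 1"
proof -
  have "orbit_partition (Suc p) \<tau> = with_blocks (Suc p) F"
  proof (intro set_eqI iffI)
    fix A assume "A \<in> orbit_partition (Suc p) \<tau>"
    then obtain x where x: "x \<in> signed (Suc p)" "A = orbit \<tau> x" by (auto simp: orbit_partition_def)
    show "A \<in> with_blocks (Suc p) F"
    proof (cases "x \<in> \<Union>F")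
      case True
      then show ?thesis using x F(2) by (auto simp: with_blocks_def)
    next
      case False
      then have "A = {x}" using x F(3) orbit_eq_singleton_iff by metis
      then show ?thesis using x False by (auto simp: with_blocks_def)
    qed
  next
    fix A assume "A \<in> with_blocks (Suc p) F"
    then consider "A \<in> F" | z where "z \<in> signed (Suc p)" "z \<notin> \<Union>F" "A = {z}"
      by (auto simp: with_blocks_def)
    then show "A \<in> orbit_partition (Suc p) \<tau>"
    proof cases
      case 1
      then have "A \<noteq> {}" "A \<subseteq> signed (Suc p)" using bf by (auto simp: block_family_def)
      then obtain x where "x \<in> A" "x \<in> signed (Suc p)" by blast
      then show ?thesis using F(2)[OF 1] by (force simp: orbit_partition_def)
    next
      case 2
      then have "orbit \<tau> z = {z}" using F(3) orbit_eq_singleton_iff by metis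
      then have "A = orbit \<tau> z" using 2(3) by simp
      then show ?thesis using 2(1) unfolding orbit_partition_def by (rule image_eqI)
    qed
  qed
  moreover have "merge_invariant_blocks (with_blocks (Suc p) F) = with_blocks (Suc p) F"
  proof -
    have "{A \<in> with_blocks (Suc p) F. uminus ` A = A} = {}"
      using F(1) by (auto simp: with_blocks_def signed_def)
    then show ?thesis by (simp add: merge_invariant_blocks_def Let_def)
  qed
  ultimately have "with_blocks (Suc p) F = merge_invariant_blocks (orbit_partition (p + 1) \<tau>)"
    by simp
  then show ?thesis using \<tau> unfolding NC_B_annular_def by (rule image_eqI)
qed

lemma with_block_pair_annular:
  assumes \<tau>: "\<tau> \<in> S_nc_B p 1"
    and A: "A \<subseteq> signed (Suc p)" "2 \<le> card A" "A \<inter> uminus ` A = {}"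
      "\<And>x. x \<in> A \<Longrightarrow> orbit \<tau> x = A" "\<And>x. x \<notin> A \<Longrightarrow> x \<notin> uminus ` A \<Longrightarrow> \<tau> x = x"
  shows "with_blocks (Suc p) {A, uminus ` A} \<in> NC_B_annular p 1"
proof (rule with_blocks_annular[OF \<tau>])
  have odd: "\<tau> (- z) = - \<tau> z" for z
    using \<tau> hyper_minus[of \<tau> "p + 1"] by (auto simp: S_nc_B_def)
  show "block_family (Suc p) {A, uminus ` A}" using A by (intro block_family_pair) auto
  have "A \<noteq> {}" using A(2) by auto
  then show "uminus ` B \<noteq> B" if "B \<in> {A, uminus ` A}" for B using that A(3) by auto
  show "orbit \<tau> x = B" if B: "B \<in> {A, uminus ` A}" and x: "x \<in> B" for B x
  proof (cases "B = A")
    case False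
    then obtain y where "y \<in> A" "x = - y" "B = uminus ` A" using B x by blast
    then show ?thesis using A(4)[of y] orbit_uminus[of \<tau> y, OF odd] by simp
  qed (use x A(4) in simp)
  show "\<tau> x = x" if "x \<notin> \<Union>{A, uminus ` A}" for x using that A(5) by auto
qed

lemma reflection_annular:
  assumes "reflection x y \<in> S_nc_B p 1" "x \<in> signed (Suc p)" "y \<in> signed (Suc p)" "\<bar>x\<bar> \<noteq> \<bar>y\<bar>"
  shows "with_blocks (Suc p) {{x, y}, uminus ` {x, y}} \<in> NC_B_annular p 1"
proof (rule with_block_pair_annular[OF assms(1)])
  have nz: "x \<noteq> 0" "y \<noteq> 0" using assms by (auto simp: signed_def)
  have v: "reflection x y x = y" "reflection x y y = x" by (auto simp: reflection_def)
  have "orbit (reflection x y) z \<subseteq> {x, y}" if "z \<in> {x, y}" for z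
  proof
    fix u assume "u \<in> orbit (reflection x y) z"
    then show "u \<in> {x, y}" using that v by induction auto
  qed
  moreover have "x \<in> orbit (reflection x y) y" "y \<in> orbit (reflection x y) x" using v orbit.base by metis+
  moreover have "x \<in> orbit (reflection x y) x" "y \<in> orbit (reflection x y) y"
    using v orbit.base orbit.step by metis+
  ultimately show "orbit (reflection x y) z = {x, y}" if "z \<in> {x, y}" for z using that by blast
  show "reflection x y z = z" if "z \<notin> {x, y}" "z \<notin> uminus ` {x, y}" for z
    using that by (auto simp: reflection_def)
  show "2 \<le> card {x, y}" using assms(4) by (auto simp: card_insert_if)
  show "{x, y} \<inter> uminus ` {x, y} = {}" using assms(4) nz by auto
qed (use assms in auto)

lemma annular_triple_card:
  assumes p: "1 \<le> p" and t: "annular_triple p a b c"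
  defines "P \<equiv> with_blocks (Suc p) {{a, b, c}, uminus ` {a, b, c}}"
  shows "P \<in> NC_B_annular p 1" "card (down (Suc p) (NC_B_annular p 1) P) = 5"
proof -
  note ne = annular_triple_distinct[OF t]
  note S = annular_triple_divisors[OF p t]
  let ?\<tau> = "triple_rotation a b c"
  let ?T = "{a, b, c}"
  have v: "?\<tau> a = b" "?\<tau> b = c" "?\<tau> c = a"
    using ne by (auto simp: triple_rotation_apply)
  have sub: "?T \<subseteq> signed (Suc p)" using ne by auto
  have card: "card ?T = 3" using ne by (auto simp: card_insert_if)
  have dis: "?T \<inter> uminus ` ?T = {}" using ne by auto
  have orb: "orbit ?\<tau> x = ?T" if x: "x \<in> ?T" for x
  proof
    show "orbit ?\<tau> x \<subseteq> ?T"
    proof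
      fix u assume "u \<in> orbit ?\<tau> x"
      then show "u \<in> ?T" using x v by induction auto
    qed
    have o1: "?\<tau> x \<in> orbit ?\<tau> x" by (rule orbit.base)
    note o2 = orbit.step[OF o1]
    note o3 = orbit.step[OF o2]
    show "?T \<subseteq> orbit ?\<tau> x" using x o1 o2 o3 v by auto
  qed
  show P: "P \<in> NC_B_annular p 1"
    unfolding P_def
  proof (rule with_block_pair_annular[OF S(1) sub _ dis orb])
    show "?\<tau> x = x" if "x \<notin> ?T" "x \<notin> uminus ` ?T" for x
      using that by (simp add: triple_rotation_apply[OF ne(1-6)])
  qed (use card in auto)
  have ab: "with_blocks (Suc p) {{a, b}, uminus ` {a, b}} \<in> NC_B_annular p 1"
    using S(2) ne by (intro reflection_annular)
  have bc: "with_blocks (Suc p) {{b, c}, uminus ` {b, c}} \<in> NC_B_annular p 1"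
    using S(3) ne by (intro reflection_annular)
  have ca: "with_blocks (Suc p) {{c, a}, uminus ` {c, a}} \<in> NC_B_annular p 1"
    using S(4) ne by (intro reflection_annular) auto
  show "card (down (Suc p) (NC_B_annular p 1) P) = 5"
    unfolding P_def
  proof (rule down_three_blocks[OF sub card dis annular_sym_partition])
    show "with_blocks (Suc p) {} \<in> NC_B_annular p 1"
      by (rule with_blocks_annular[OF S(5)]) (auto simp: block_family_def)
    show "with_blocks (Suc p) {B, uminus ` B} \<in> NC_B_annular p 1" if B: "B \<subseteq> ?T" "2 \<le> card B" for B
    proof -
      have "B \<in> Pow ?T" using B by simp
      then have "B \<in> {{}, {a}, {b}, {c}, {a, b}, {b, c}, {c, a}, {a, b, c}}"
        unfolding Pow_insert Pow_empty by auto
      then have "B = {a, b} \<or> B = {b, c} \<or> B = {c, a} \<or> B = ?T" using B(2) by auto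
      then show ?thesis using ab bc ca P unfolding P_def by auto
    qed
  qed
qed

section \<open>Non-crossing partitions on the circle\<close>

lemma circle_point_minus:
  assumes "0 < n" "i \<noteq> 0" shows "circle_point n (- i) = - circle_point n i"
proof -
  have pos: "circle_point n (- i) = - circle_point n i" if "0 < i" for i
  proof -
    have "pi * of_int (int n + i) / of_nat n = pi + pi * of_int i / real n"
      using assms(1) by (simp add: field_simps)
    then have "circle_point n (- i) = cis (pi + pi * of_int i / real n)"
      using that by (simp add: circle_point_def)
    also have "\<dots> = - circle_point n i"
      using that by (simp add: circle_point_def cis_mult[symmetric])
    finally show ?thesis .
  qed
  show ?thesis using pos[of i] pos[of "- i"] assms(2) by (cases "0 < i") auto
qed

lemma norm_circle_point [simp]: "norm (circle_point n i) = 1"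
  by (simp add: circle_point_def)

lemma inj_on_circle_point: "inj_on (circle_point n) (signed n)"
proof (rule inj_onI)
  define k where "k i = (if 0 < i then i else int n + \<bar>i\<bar>)" for i
  fix i j assume i: "i \<in> signed n" and j: "j \<in> signed n" and eq: "circle_point n i = circle_point n j"
  have n: "0 < n" using i by (auto simp: signed_def)
  have "exp (\<i> * of_real (pi * of_int (k i) / of_nat n)) = exp (\<i> * of_real (pi * of_int (k j) / of_nat n))"
    using eq by (simp add: circle_point_def k_def cis_conv_exp)
  then obtain m :: int where "\<i> * of_real (pi * of_int (k i) / of_nat n)
      = \<i> * of_real (pi * of_int (k j) / of_nat n) + of_int (2 * m) * of_real pi * \<i>"
    unfolding exp_eq by (auto simp: mult_ac)
  then have "\<i> * of_real (pi * of_int (k i) / of_nat n)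
      = \<i> * of_real (pi * of_int (k j) / of_nat n + of_int (2 * m) * pi)"
    by (simp add: algebra_simps)
  then have "complex_of_real (pi * of_int (k i) / of_nat n)
      = complex_of_real (pi * of_int (k j) / of_nat n + of_int (2 * m) * pi)"
    by (simp only: mult_cancel_left) simp
  then have "pi * of_int (k i) / of_nat n = pi * of_int (k j) / of_nat n + of_int (2 * m) * pi"
    by (simp only: of_real_eq_iff)
  then have "pi * of_int (k i) = pi * (of_int (k j) + of_int (2 * m) * of_nat n)"
    using n by (simp add: field_simps)
  then have "real_of_int (k i) = of_int (k j + 2 * m * int n)" by simp
  then have k: "k i = k j + 2 * m * int n" by (simp only: of_int_eq_iff)
  have r: "1 \<le> k i" "k i \<le> 2 * int n" "1 \<le> k j" "k j \<le> 2 * int n"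
    using i j by (auto simp: k_def signed_def)
  have "m = 0"
  proof (rule ccontr)
    assume "m \<noteq> 0"
    then consider "1 \<le> m" | "m \<le> - 1" by linarith
    then show False
    proof cases
      case 1
      then have "1 * int n \<le> m * int n" by (intro mult_right_mono) auto
      then show False using k r by linarith
    next
      case 2
      then have "m * int n \<le> - 1 * int n" by (intro mult_right_mono) auto
      then show False using k r by linarith
    qed
  qed
  then have "k i = k j" using k by simp
  then show "i = j" using i j by (auto simp: k_def signed_def split: if_splits)
qed

text \<open>
  The functional \<open>w \<mapsto> z \<bullet> w\<close> is smaller than 1 at every other unit vector.
\<close>

lemma unit_vector_not_in_hull:
  fixes z :: "'a :: real_inner"
  assumes "norm z = 1" "\<And>w. w \<in> S \<Longrightarrow> norm w = 1" "z \<notin> S"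
  shows "z \<notin> convex hull S"
proof -
  have "S \<subseteq> {w. inner z w < 1}"
  proof
    fix w assume w: "w \<in> S"
    then have "0 < norm (z - w) ^ 2" using assms(3) by auto
    then show "w \<in> {w. inner z w < 1}" using assms(1) assms(2)[OF w] by (simp add: dot_norm_neg)
  qed
  then have "convex hull S \<subseteq> {w. inner z w < 1}"
    by (rule hull_minimal) (rule convex_halfspace_lt)
  moreover have "inner z z = 1" using assms(1) by (simp add: dot_square_norm)
  ultimately show ?thesis by auto
qed

text \<open>
  The functional given by \<open>u + v\<close> is positive on one chord and negative on the other.
\<close>

lemma opposite_chords_disjoint:
  fixes u v :: "'a :: real_inner"
  assumes "norm u = 1" "norm v = 1" "u \<noteq> - v"
  shows "convex hull {u, v} \<inter> convex hull {- u, - v} = {}"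
proof -
  have "u + v \<noteq> 0" using assms(3) by (simp add: eq_neg_iff_add_eq_0)
  then have "inner (u + v) (u + v) > 0" by simp
  moreover have sq: "inner u u = 1" "inner v v = 1" using assms(1,2) by (simp_all add: dot_square_norm)
  then have "inner (u + v) (u + v) = 2 * (1 + inner u v)"
    unfolding inner_add_left inner_add_right inner_commute[of v u] by simp
  ultimately have pos: "0 < 1 + inner u v" by simp
  have i: "inner (u + v) u = 1 + inner u v" "inner (u + v) v = 1 + inner u v"
    by (simp_all add: inner_add_left sq inner_commute[of v u])
  have "convex hull {u, v} \<subseteq> {w. inner (u + v) w > 0}"
    by (rule hull_minimal) (use pos in \<open>auto simp: i intro: convex_halfspace_gt\<close>)
  moreover have "convex hull {- u, - v} \<subseteq> {w. inner (u + v) w < 0}"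
    by (rule hull_minimal) (use pos in \<open>auto simp: i intro: convex_halfspace_lt\<close>)
  ultimately show ?thesis by fastforce
qed

lemma NC_B_iff: "P \<in> NC_B n \<longleftrightarrow> sym_partition n P \<and> noncrossing n P"
  by (auto simp: NC_B_def sym_partition_def)

lemma with_blocks_NC_B:
  assumes bf: "block_family n F"
    and nc: "\<And>A B. A \<in> F \<Longrightarrow> B \<in> F \<Longrightarrow> A \<noteq> B \<Longrightarrow>
      convex hull (circle_point n ` A) \<inter> convex hull (circle_point n ` B) = {}"
  shows "with_blocks n F \<in> NC_B n"
proof -
  have sing: "convex hull (circle_point n ` {z}) \<inter> convex hull (circle_point n ` B) = {}"
    if "z \<in> signed n" "z \<notin> B" "B \<subseteq> signed n" for z B
  proof -
    have "circle_point n z \<notin> circle_point n ` B"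
      using that inj_on_circle_point[of n] by (meson inj_on_image_mem_iff)
    then have "circle_point n z \<notin> convex hull (circle_point n ` B)"
      by (intro unit_vector_not_in_hull) auto
    then show ?thesis by simp
  qed
  have "noncrossing n (with_blocks n F)"
    unfolding noncrossing_def
  proof (intro ballI impI)
    fix A B assume A: "A \<in> with_blocks n F" and B: "B \<in> with_blocks n F" and AB: "A \<noteq> B"
    have sub: "A \<subseteq> signed n" "B \<subseteq> signed n" and disj: "A \<inter> B = {}"
      using sym_partition_with_blocks[OF bf] A B AB
      by (auto simp: sym_partition_def partition_on_def dest: disjointD)
    show "convex hull (circle_point n ` A) \<inter> convex hull (circle_point n ` B) = {}"
    proof (cases "A \<in> F \<and> B \<in> F")
      case True then show ?thesis using nc AB by blast
    next
      case False
      then consider z where "A = {z}" | z where "B = {z}" using A B by (auto simp: with_blocks_def)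
      then show ?thesis
      proof cases
        case 1 then show ?thesis using sing[of _ B] sub disj by auto
      next
        case 2 then show ?thesis using sing[of _ A] sub disj by (auto simp: Int_commute)
      qed
    qed
  qed
  then show ?thesis using sym_partition_with_blocks[OF bf] by (simp add: NC_B_iff)
qed

lemma sub_blocks_NC_B:
  assumes P: "P \<in> NC_B n" and F: "F \<subseteq> large_blocks P" "\<And>A. A \<in> F \<Longrightarrow> uminus ` A \<in> F"
  shows "block_family n F" "with_blocks n F \<in> down n (NC_B n) P"
proof -
  have sp: "sym_partition n P" using P by (simp add: NC_B_iff)
  have G: "block_family n (large_blocks P)" by (rule sym_partition_eq_with_blocks(1)[OF sp])
  show bf: "block_family n F"
    unfolding block_family_def
  proof (intro conjI ballI)
    show "\<Union>F \<subseteq> signed n" using G F(1) unfolding block_family_def by blast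
    show "disjoint F" using G F(1) unfolding block_family_def by (meson pairwise_subset)
  qed (use G F in \<open>auto simp: block_family_def\<close>)
  have FP: "A \<in> P" if "A \<in> F" for A using that F(1) by (auto simp: large_blocks_def)
  have "with_blocks n F \<in> NC_B n"
    using P FP by (intro with_blocks_NC_B[OF bf]) (auto simp: NC_B_iff noncrossing_def)
  moreover have "refines (signed n) (with_blocks n F) P"
    using sp FP by (intro refines_with_blocks[OF bf]) (auto simp: sym_partition_def)
  ultimately show "with_blocks n F \<in> down n (NC_B n) P" by (simp add: down_def)
qed

lemma doubleton_NC_B:
  assumes "x \<in> signed n" "y \<in> signed n" "x \<noteq> y"
  shows "with_blocks n {{x, y}, uminus ` {x, y}} \<in> NC_B n"
proof (rule with_blocks_NC_B[OF block_family_doubleton[OF assms]])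
  have nz: "x \<noteq> 0" "y \<noteq> 0" and n: "0 < n" using assms by (auto simp: signed_def)
  have *: "convex hull (circle_point n ` {x, y}) \<inter> convex hull (circle_point n ` uminus ` {x, y}) = {}"
    if "{x, y} \<noteq> uminus ` {x, y}"
  proof -
    have "y \<noteq> - x" using that by auto
    then have "circle_point n x \<noteq> circle_point n (- y)"
      using assms inj_on_circle_point[of n] by (auto dest: inj_onD)
    then show ?thesis
      using opposite_chords_disjoint[of "circle_point n x" "circle_point n y"]
      by (simp add: circle_point_minus n nz)
  qed
  show "convex hull (circle_point n ` A) \<inter> convex hull (circle_point n ` B) = {}"
    if A: "A \<in> {{x, y}, uminus ` {x, y}}" and B: "B \<in> {{x, y}, uminus ` {x, y}}" and AB: "A \<noteq> B" for A B
  proof -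
    consider "A = {x, y}" "B = uminus ` {x, y}" | "B = {x, y}" "A = uminus ` {x, y}"
      using A B AB by blast
    then show ?thesis
    proof cases
      case 1 then show ?thesis using * AB by simp
    next
      case 2 then show ?thesis using * AB by (simp add: Int_commute)
    qed
  qed
qed

lemma doubleton_down:
  assumes P: "P \<in> NC_B n" and A: "A \<in> P" "x \<in> A" "y \<in> A" "x \<noteq> y"
  shows "with_blocks n {{x, y}, uminus ` {x, y}} \<in> down n (NC_B n) P"
    "block_family n {{x, y}, uminus ` {x, y}}"
proof -
  have sp: "partition_on (signed n) P" "uminus ` A \<in> P" using P A by (auto simp: NC_B_def)
  have xy: "x \<in> signed n" "y \<in> signed n" using A partition_onD1[OF sp(1)] by auto
  show bf: "block_family n {{x, y}, uminus ` {x, y}}" by (rule block_family_doubleton[OF xy A(4)])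
  have "refines (signed n) (with_blocks n {{x, y}, uminus ` {x, y}}) P"
  proof (rule refines_with_blocks[OF bf sp(1)])
    fix B assume "B \<in> {{x, y}, uminus ` {x, y}}"
    then have "B \<subseteq> A \<or> B \<subseteq> uminus ` A" using A by auto
    then show "\<exists>C\<in>P. B \<subseteq> C" using A(1) sp(2) by blast
  qed
  then show "with_blocks n {{x, y}, uminus ` {x, y}} \<in> down n (NC_B n) P"
    using doubleton_NC_B[OF xy A(4)] by (simp add: down_def)
qed

text \<open>
  The triangle and its negative both contain the centre of the circle: the point of \<open>j\<close> is a positive
  combination of the points of \<open>i\<close> and \<open>k\<close>, which are less than a half turn apart.
\<close>

lemma crossing_triple:
  assumes "1 \<le> i" "i < j" "j < k" "k \<le> int n"
  shows "with_blocks n {{i, - j, k}, uminus ` {i, - j, k}} \<notin> NC_B n"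
proof
  assume "with_blocks n {{i, - j, k}, uminus ` {i, - j, k}} \<in> NC_B n"
  then have nc: "noncrossing n (with_blocks n {{i, - j, k}, uminus ` {i, - j, k}})"
    by (simp add: NC_B_iff)
  have ne: "{i, - j, k} \<noteq> uminus ` {i, - j, k}" using assms by auto
  have n: "0 < n" using assms by auto
  define u where "u x = circle_point n x" for x
  have neg: "u (- x) = - u x" if "1 \<le> x" for x
    using that circle_point_minus[OF n, of x] by (simp add: u_def)
  have "convex hull (circle_point n ` {i, - j, k})
      \<inter> convex hull (circle_point n ` uminus ` {i, - j, k}) = {}"
    using nc ne unfolding noncrossing_def by (auto simp: with_blocks_def)
  then have disj: "convex hull {u i, - u j, u k} \<inter> convex hull {- u i, u j, - u k} = {}"
    using neg[of i] neg[of j] neg[of k] assms by (simp add: u_def)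
  define \<theta> where "\<theta> x = pi * of_int x / real n" for x :: int
  have u: "u x = cis (\<theta> x)" if "1 \<le> x" for x
    using that by (simp add: u_def \<theta>_def circle_point_def)
  have sin: "0 < sin (\<theta> y - \<theta> x)" if "1 \<le> x" "x < y" "y \<le> int n" for x y
  proof (rule sin_gt_zero)
    have e: "\<theta> y - \<theta> x = pi * (of_int (y - x) / real n)" by (simp add: \<theta>_def right_diff_distrib diff_divide_distrib)
    show "0 < \<theta> y - \<theta> x" using that n by (simp add: e)
    have "of_int (y - x) / real n < 1" using that n by (simp add: field_simps)
    then have "pi * (of_int (y - x) / real n) < pi * 1" by (intro mult_strict_left_mono) auto
    then show "\<theta> y - \<theta> x < pi" by (simp add: e)
  qed
  define a b c where "a = sin (\<theta> k - \<theta> j)" and "b = sin (\<theta> k - \<theta> i)" and "c = sin (\<theta> j - \<theta> i)"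
  have abc: "0 < a" "0 < b" "0 < c" using sin assms by (auto simp: a_def b_def c_def)
  have zero: "a *\<^sub>R u i - b *\<^sub>R u j + c *\<^sub>R u k = 0"
    using assms by (simp add: u complex_eq_iff a_def b_def c_def sin_diff algebra_simps)
  define s where "s = a + b + c"
  have s: "0 < s" using abc by (simp add: s_def)
  have comb: "(a / s) *\<^sub>R x + (b / s) *\<^sub>R y + (c / s) *\<^sub>R z \<in> convex hull {x, y, z}" for x y z :: complex
  proof -
    have "a / s + b / s + c / s = 1" using s by (simp add: s_def add_divide_distrib[symmetric])
    moreover have "0 \<le> a / s" "0 \<le> b / s" "0 \<le> c / s" using abc s by auto
    ultimately show ?thesis unfolding convex_hull_3 by blast
  qed
  have "(a / s) *\<^sub>R u i + (b / s) *\<^sub>R (- u j) + (c / s) *\<^sub>R u k = (1 / s) *\<^sub>R (a *\<^sub>R u i - b *\<^sub>R u j + c *\<^sub>R u k)"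
    by (simp add: scaleR_add_right scaleR_diff_right)
  then have "0 \<in> convex hull {u i, - u j, u k}"
    using comb[of "u i" "- u j" "u k"] by (simp add: zero)
  moreover have "(a / s) *\<^sub>R (- u i) + (b / s) *\<^sub>R u j + (c / s) *\<^sub>R (- u k)
      = - (1 / s) *\<^sub>R (a *\<^sub>R u i - b *\<^sub>R u j + c *\<^sub>R u k)"
    by (simp add: scaleR_add_right scaleR_diff_right)
  then have "0 \<in> convex hull {- u i, u j, - u k}"
    using comb[of "- u i" "u j" "- u k"] by (simp add: zero)
  ultimately show False using disj by blast
qed

lemma card_down_ge:
  assumes "\<And>F. F \<in> \<F> \<Longrightarrow> block_family n F" "\<And>F. F \<in> \<F> \<Longrightarrow> with_blocks n F \<in> down n (NC_B n) P"
  shows "card \<F> \<le> card (down n (NC_B n) P)"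
proof -
  have "finite (down n (NC_B n) P)"
    by (rule finite_subset[OF _ finite_sym_partitions[of n]]) (auto simp: down_def NC_B_iff)
  moreover have "inj_on (with_blocks n) \<F>"
    by (rule inj_on_subset[OF inj_on_with_blocks]) (use assms(1) in auto)
  ultimately show ?thesis
    using assms(2) by (intro card_inj_on_le[where f = "with_blocks n"]) auto
qed

text \<open>
  Blocks with at most two elements can only be kept or split into singletons, independently for each
  pair of opposite blocks; so the partitions below correspond to the subsets of the set of such
  pairs.
\<close>

lemma down_small_blocks:
  assumes P: "P \<in> NC_B n" and small: "\<And>A. A \<in> P \<Longrightarrow> card A \<le> 2"
  shows "\<exists>k. card (down n (NC_B n) P) = 2 ^ k"
proof -
  define K where "K = (\<lambda>A. {A, uminus ` A}) ` large_blocks P"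
  have sp: "sym_partition n P" using P by (simp add: NC_B_iff)
  have bf: "block_family n (large_blocks P)" by (rule sym_partition_eq_with_blocks(1)[OF sp])
  have sym: "uminus ` A \<in> large_blocks P" if "A \<in> large_blocks P" for A
    using that bf by (simp add: block_family_def)
  have sub: "\<Union>H \<subseteq> large_blocks P" and symH: "\<And>A. A \<in> \<Union>H \<Longrightarrow> uminus ` A \<in> \<Union>H"
    if H: "H \<subseteq> K" for H
  proof -
    have *: "\<exists>h B. A \<in> h \<and> h \<in> H \<and> h = {B, uminus ` B} \<and> B \<in> large_blocks P" if A: "A \<in> \<Union>H" for A
    proof -
      obtain h where h: "h \<in> H" "A \<in> h" using A by (rule UnionE)
      then have "h \<in> K" using H by (simp add: subset_iff)
      then obtain B where "h = {B, uminus ` B}" "B \<in> large_blocks P" unfolding K_def by (rule imageE)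
      with h show ?thesis by auto
    qed
    show "\<Union>H \<subseteq> large_blocks P"
    proof
      fix A assume "A \<in> \<Union>H"
      then show "A \<in> large_blocks P" using *[of A] sym by auto
    qed
    show "uminus ` A \<in> \<Union>H" if A: "A \<in> \<Union>H" for A
    proof -
      obtain h B where h: "A \<in> h" "h \<in> H" "h = {B, uminus ` B}" using *[OF A] by blast
      then have "uminus ` A \<in> h" by auto
      then show ?thesis using h(2) by (rule UnionI[rotated])
    qed
  qed
  have "down n (NC_B n) P = (\<lambda>H. with_blocks n (\<Union>H)) ` Pow K"
  proof (intro set_eqI iffI)
    fix Q assume "Q \<in> down n (NC_B n) P"
    then have sQ: "sym_partition n Q" and ref: "refines (signed n) Q P"
      by (auto simp: down_def NC_B_iff)
    note Q = sym_partition_eq_with_blocks[OF sQ]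
    have "large_blocks Q \<subseteq> large_blocks P"
    proof
      fix B assume "B \<in> large_blocks Q"
      then have B: "B \<in> Q" "2 \<le> card B" by (auto simp: large_blocks_def)
      then obtain C where C: "C \<in> P" "B \<subseteq> C" using ref by (auto simp: refines_def)
      have "C \<subseteq> signed n" using C(1) sp by (auto simp: sym_partition_def partition_on_def)
      then have "finite C" using finite_signed finite_subset by blast
      then have "B = C" using B(2) C small[OF C(1)] by (intro card_seteq) auto
      then show "B \<in> large_blocks P" using B C by (simp add: large_blocks_def)
    qed
    moreover have "\<Union>((\<lambda>A. {A, uminus ` A}) ` large_blocks Q) = large_blocks Q"
      using Q(1) by (auto simp: block_family_def)
    ultimately show "Q \<in> (\<lambda>H. with_blocks n (\<Union>H)) ` Pow K"
      using Q(2) by (intro image_eqI[where x = "(\<lambda>A. {A, uminus ` A}) ` large_blocks Q"]) (auto simp: K_def)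
  next
    fix Q assume "Q \<in> (\<lambda>H. with_blocks n (\<Union>H)) ` Pow K"
    then obtain H where H: "H \<subseteq> K" "Q = with_blocks n (\<Union>H)" by blast
    then show "Q \<in> down n (NC_B n) P"
      using sub_blocks_NC_B(2)[OF P sub symH] by blast
  qed
  moreover have "inj_on (\<lambda>H. with_blocks n (\<Union>H)) (Pow K)"
  proof (rule inj_onI)
    fix H1 H2 assume H: "H1 \<in> Pow K" "H2 \<in> Pow K" and eq: "with_blocks n (\<Union>H1) = with_blocks n (\<Union>H2)"
    have "block_family n (\<Union>H1)" "block_family n (\<Union>H2)"
      using H sub_blocks_NC_B(1)[OF P sub symH] by blast+
    then have U: "\<Union>H1 = \<Union>H2" using inj_on_with_blocks[of n] eq by (auto dest: inj_onD)
    have "H \<subseteq> H'" if HH: "H \<subseteq> K" "H' \<subseteq> K" "\<Union>H = \<Union>H'" for H H'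
    proof
      fix k assume k: "k \<in> H"
      then obtain A where A: "k = {A, uminus ` A}" using HH(1) by (auto simp: K_def)
      then obtain k' where k': "k' \<in> H'" "A \<in> k'" using k HH(3) by blast
      then obtain B where "k' = {B, uminus ` B}" using HH(2) by (auto simp: K_def)
      then have "k' = k" using k'(2) A by auto
      then show "k \<in> H'" using k'(1) by simp
    qed
    from this[of H1 H2] this[of H2 H1] show "H1 = H2" using H U by auto
  qed
  moreover have "finite K"
  proof -
    have "finite (large_blocks P)"
      by (rule finite_subset[of _ "Pow (signed n)"]) (use bf in \<open>auto simp: block_family_def\<close>)
    then show ?thesis by (simp add: K_def)
  qed
  ultimately show ?thesis by (auto simp: card_image card_Pow)
qed

lemma power_two_ne_five: "(2::nat) ^ k \<noteq> 5"
proof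
  assume "(2::nat) ^ k = 5"
  then have "odd ((2::nat) ^ k)" by simp
  then have "k = 0" by simp
  then show False using \<open>(2::nat) ^ k = 5\<close> by simp
qed

text \<open>
  As 5 is not a power of two, some block \<open>A\<close> has at least three elements. If \<open>A\<close> is
  inversion-invariant, it contains \<open>x, - x, y, - y\<close>, which gives four atoms below \<open>P\<close>; with the bottom
  element and \<open>P\<close> itself these are six elements. Otherwise each pair in \<open>A\<close> gives an atom, and the
  count leaves room for only three of them. Then \<open>A\<close> has three elements, and there is no room for a
  further block, because the partition with large blocks \<open>A\<close> and \<open>- A\<close> would be a sixth element.
\<close>

lemma NC_B_down_five:
  assumes P: "P \<in> NC_B n" and five: "card (down n (NC_B n) P) = 5"
  shows "\<exists>T. T \<subseteq> signed n \<and> card T = 3 \<and> T \<inter> uminus ` T = {} \<and> P = with_blocks n {T, uminus ` T}"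
proof -
  have sp: "sym_partition n P" using P by (simp add: NC_B_iff)
  note G = sym_partition_eq_with_blocks[OF sp]
  have part: "\<Union>P = signed n" "disjoint P" "\<And>A. A \<in> P \<Longrightarrow> uminus ` A \<in> P"
    using sp by (auto simp: sym_partition_def partition_on_def)
  have empty: "block_family n {}" "with_blocks n {} \<in> down n (NC_B n) P"
    using sub_blocks_NC_B[OF P, of "{}"] by auto
  have self: "with_blocks n (large_blocks P) \<in> down n (NC_B n) P"
    using sub_blocks_NC_B(2)[OF P, of "large_blocks P"] G(1) by (auto simp: block_family_def)
  obtain A where A: "A \<in> P" "3 \<le> card A"
    using down_small_blocks[OF P] five power_two_ne_five
    by (metis not_less_eq_eq numeral_2_eq_2 numeral_3_eq_3)
  have finA: "finite A" using A(2) by (intro card_ge_0_finite) auto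
  have AL: "A \<in> large_blocks P" using A by (simp add: large_blocks_def)
  let ?E = "\<lambda>e. {e, uminus ` e}"
  have L_ne: "large_blocks P \<noteq> ?E e" if "card e \<le> 2" for e
    using that AL A(2) by (auto dest: arg_cong[where f = card])
  have A_ne: "A \<inter> uminus ` A = {}"
  proof (rule ccontr)
    assume "A \<inter> uminus ` A \<noteq> {}"
    then have inv: "uminus ` A = A" using A(1) part(2,3) by (auto dest: disjointD)
    have neg: "- z \<in> A" if "z \<in> A" for z using that inv by (metis image_eqI)
    have nz: "z \<noteq> 0" if "z \<in> A" for z using that A(1) part(1) by (metis UnionI signed_0)
    have "A \<noteq> {}" using A(2) by auto
    then obtain x where x: "x \<in> A" by blast
    have "\<not> A \<subseteq> {x, - x}"
    proof
      assume "A \<subseteq> {x, - x}"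
      then have "card A \<le> card {x, - x}" by (intro card_mono) auto
      also have "\<dots> \<le> 2" by (simp add: card_insert_if)
      finally show False using A(2) by simp
    qed
    then obtain y where y: "y \<in> A" "y \<noteq> x" "y \<noteq> - x" by blast
    have xy: "x \<noteq> 0" "y \<noteq> 0" using nz x y by auto
    define \<F> where "\<F> = {{}, large_blocks P, ?E {x, y}, ?E {x, - y}, ?E {x, - x}, ?E {y, - y}}"
    have "card \<F> = 6"
    proof -
      have d: "{x, y} \<notin> ?E {x, - y}" "{x, y} \<notin> ?E {x, - x}" "{x, y} \<notin> ?E {y, - y}"
        "{x, - y} \<notin> ?E {x, - x}" "{x, - y} \<notin> ?E {y, - y}" "{x, - x} \<notin> ?E {y, - y}"
        using xy y by (auto simp: doubleton_eq_iff)
      have neqI: "?E e \<noteq> ?E f" if "e \<notin> ?E f" for e f :: "int set"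
        using that by (metis insertI1)
      note d[THEN neqI]
      moreover have "large_blocks P \<noteq> ?E {x, y}" "large_blocks P \<noteq> ?E {x, - y}"
        "large_blocks P \<noteq> ?E {x, - x}" "large_blocks P \<noteq> ?E {y, - y}"
        by (rule L_ne, simp add: card_insert_if)+
      moreover have "large_blocks P \<noteq> {}" using AL by blast
      ultimately show ?thesis unfolding \<F>_def by (simp add: card_insert_if)
    qed
    moreover have "block_family n F \<and> with_blocks n F \<in> down n (NC_B n) P" if "F \<in> \<F>" for F
    proof -
      have E: "block_family n (?E {z, w}) \<and> with_blocks n (?E {z, w}) \<in> down n (NC_B n) P"
        if "z \<in> A" "w \<in> A" "z \<noteq> w" for z w
        using doubleton_down[OF P A(1) that] by simp
      have "x \<noteq> - x" "y \<noteq> - y" "x \<noteq> - y" "x \<noteq> y" using xy y by auto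
      note this E[OF x(1) y(1)] E[OF x(1) neg[OF y(1)]] E[OF x(1) neg[OF x(1)]] E[OF y(1) neg[OF y(1)]]
      with that show ?thesis
        using empty self G(1) unfolding \<F>_def by (elim insertE) (simp_all only: empty_iff simp_thms)
    qed
    ultimately have "6 \<le> card (down n (NC_B n) P)" using card_down_ge[of \<F> n P] by auto
    then show False using five by simp
  qed
  define \<P> where "\<P> = {e. e \<subseteq> A \<and> card e = 2}"
  have inj: "inj_on ?E \<P>"
  proof (rule inj_onI)
    fix e f assume e: "e \<in> \<P>" and f: "f \<in> \<P>" and eq: "?E e = ?E f"
    have "f \<noteq> {}" using f by (auto simp: \<P>_def)
    moreover have "uminus ` e \<inter> A = {}" using e A_ne by (auto simp: \<P>_def)
    ultimately have "f \<noteq> uminus ` e" using f by (auto simp: \<P>_def)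
    then show "e = f" using eq by (metis insertI1 insertE singletonD)
  qed
  have cardP: "card (?E ` \<P>) = card A choose 2"
    using card_image[OF inj] n_subsets[OF finA, of 2] by (simp add: \<P>_def)
  have finP: "finite \<P>" using finA by (simp add: \<P>_def)
  have pairs: "block_family n F \<and> with_blocks n F \<in> down n (NC_B n) P" if F: "F \<in> ?E ` \<P>" for F
  proof -
    obtain e where "e \<in> \<P>" "F = ?E e" using F by blast
    then have e: "e \<subseteq> A" "card e = 2" "F = ?E e" by (simp_all add: \<P>_def)
    then obtain x y where "e = {x, y}" "x \<noteq> y" by (auto simp: card_2_iff)
    then show ?thesis using doubleton_down[OF P A(1), of x y] e by auto
  qed
  define \<F> where "\<F> = insert {} (insert (large_blocks P) (?E ` \<P>))"
  have L_notin: "large_blocks P \<notin> ?E ` \<P>"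
  proof
    assume "large_blocks P \<in> ?E ` \<P>"
    then obtain e where "e \<in> \<P>" "large_blocks P = ?E e" by blast
    then show False using L_ne[of e] by (simp add: \<P>_def)
  qed
  have card\<F>: "card \<F> = 2 + (card A choose 2)"
  proof -
    have "card (insert (large_blocks P) (?E ` \<P>)) = Suc (card A choose 2)"
      using L_notin finP cardP by (subst card_insert_disjoint) auto
    moreover have "{} \<notin> insert (large_blocks P) (?E ` \<P>)" using AL by auto
    ultimately show ?thesis unfolding \<F>_def using finP by (subst card_insert_disjoint) auto
  qed
  have \<F>: "block_family n F" "with_blocks n F \<in> down n (NC_B n) P" if "F \<in> \<F>" for F
    using that pairs empty self G(1) by (auto simp: \<F>_def)
  have le3: "card A choose 2 \<le> 3" using card_down_ge[of \<F> n P, OF \<F>] card\<F> five by simp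
  have "\<not> 4 \<le> card A"
  proof
    assume "4 \<le> card A"
    then have "4 * 3 \<le> card A * (card A - 1)" by (intro mult_le_mono) auto
    then have "6 \<le> card A choose 2" unfolding choose_two by linarith
    then show False using le3 by simp
  qed
  then have A3: "card A = 3" using A(2) by simp
  have EA: "block_family n (?E A)" "with_blocks n (?E A) \<in> down n (NC_B n) P"
  proof -
    have "?E A \<subseteq> large_blocks P" using AL G(1) by (simp add: block_family_def)
    moreover have "uminus ` B \<in> ?E A" if "B \<in> ?E A" for B using that by auto
    ultimately show "block_family n (?E A)" "with_blocks n (?E A) \<in> down n (NC_B n) P"
      using sub_blocks_NC_B[OF P, of "?E A"] by simp_all
  qed
  have "large_blocks P = ?E A"
  proof (rule ccontr)
    assume ne: "large_blocks P \<noteq> ?E A"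
    have "?E A \<notin> ?E ` \<P>"
    proof
      assume "?E A \<in> ?E ` \<P>"
      then obtain e where "e \<in> \<P>" "?E A = ?E e" by blast
      then have "card e = 2" "A \<in> ?E e" by (auto simp: \<P>_def)
      then show False using A3 by auto
    qed
    then have "?E A \<notin> \<F>" using ne by (auto simp: \<F>_def)
    then have "card (insert (?E A) \<F>) = 6"
      using card\<F> A3 finP by (simp add: \<F>_def numeral_eq_Suc)
    moreover have "card (insert (?E A) \<F>) \<le> card (down n (NC_B n) P)"
      by (rule card_down_ge) (use \<F> EA in auto)
    ultimately show False using five by simp
  qed
  then have "P = with_blocks n (?E A)" using G(2) by simp
  moreover have "A \<subseteq> signed n" using A(1) part(1) by blast
  ultimately show ?thesis using A3 A_ne by blast
qed

section \<open>Comparing the two posets\<close>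

text \<open>
  Up to a global sign there are four sign patterns for given absolute values. In the cyclic order
  \<open>1, \<dots>, p + 1, - 1, \<dots>, - (p + 1)\<close> the three patterns other than \<open>i, - j, k\<close> consist of three consecutive ones among
  the six points \<open>i, j, k, - i, - j, - k\<close>, and removing the points \<open>\<plusminus>(p + 1)\<close> from the circle does not
  disturb this order.
\<close>

lemma triple_annular_or_crossing:
  assumes p: "1 \<le> p" and T: "T \<subseteq> signed (Suc p)" "card T = 3" "T \<inter> uminus ` T = {}"
  shows "(\<exists>a b c. annular_triple p a b c \<and> {T, uminus ` T} = {{a, b, c}, uminus ` {a, b, c}}) \<or>
    (\<exists>i j k. 1 \<le> i \<and> i < j \<and> j < k \<and> k \<le> int (Suc p) \<and>
      {T, uminus ` T} = {{i, - j, k}, uminus ` {i, - j, k}})"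
proof -
  obtain x y z where xyz: "T = {x, y, z}" "x \<noteq> y" "y \<noteq> z" "x \<noteq> z"
    using T(2) by (auto simp: card_3_iff)
  have abs_ne: "\<bar>u\<bar> \<noteq> \<bar>v\<bar>" if "u \<in> T" "v \<in> T" "u \<noteq> v" for u v
  proof
    assume "\<bar>u\<bar> = \<bar>v\<bar>"
    then have "u = - v" using that(3) by arith
    then show False using that T(3) by blast
  qed
  have xyz_abs: "\<bar>x\<bar> \<noteq> \<bar>y\<bar>" "\<bar>y\<bar> \<noteq> \<bar>z\<bar>" "\<bar>x\<bar> \<noteq> \<bar>z\<bar>" using abs_ne xyz by auto
  obtain u v w where uvw: "T = {u, v, w}" "\<bar>u\<bar> < \<bar>v\<bar>" "\<bar>v\<bar> < \<bar>w\<bar>"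
  proof -
    consider "\<bar>x\<bar> < \<bar>y\<bar>" "\<bar>y\<bar> < \<bar>z\<bar>" | "\<bar>x\<bar> < \<bar>z\<bar>" "\<bar>z\<bar> < \<bar>y\<bar>" | "\<bar>y\<bar> < \<bar>x\<bar>" "\<bar>x\<bar> < \<bar>z\<bar>"
      | "\<bar>y\<bar> < \<bar>z\<bar>" "\<bar>z\<bar> < \<bar>x\<bar>" | "\<bar>z\<bar> < \<bar>x\<bar>" "\<bar>x\<bar> < \<bar>y\<bar>" | "\<bar>z\<bar> < \<bar>y\<bar>" "\<bar>y\<bar> < \<bar>x\<bar>"
      using xyz_abs by linarith
    then show ?thesis
    proof cases
      case 1 then show ?thesis using xyz(1) by (intro that[of x y z])
    next
      case 2 then show ?thesis using xyz(1) by (intro that[of x z y]) auto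
    next
      case 3 then show ?thesis using xyz(1) by (intro that[of y x z]) auto
    next
      case 4 then show ?thesis using xyz(1) by (intro that[of y z x]) auto
    next
      case 5 then show ?thesis using xyz(1) by (intro that[of z x y]) auto
    next
      case 6 then show ?thesis using xyz(1) by (intro that[of z y x]) auto
    qed
  qed
  obtain i s t where ist: "{T, uminus ` T} = {{i, s, t}, uminus ` {i, s, t}}" "0 < i" "i < \<bar>s\<bar>" "\<bar>s\<bar> < \<bar>t\<bar>" "\<bar>t\<bar> \<le> int (Suc p)"
  proof (cases "0 < u")
    case True
    show ?thesis by (rule that[of u v w]) (use True uvw T(1) in \<open>auto simp: signed_def\<close>)
  next
    case False
    have "u \<noteq> 0" using uvw(1) T(1) by (auto simp: signed_def)
    show ?thesis
      by (rule that[of "- u" "- v" "- w"])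
        (use False \<open>u \<noteq> 0\<close> uvw T(1) in \<open>auto simp: signed_def insert_commute\<close>)
  qed
  define j k where "j = \<bar>s\<bar>" and "k = \<bar>t\<bar>"
  have ijk: "1 \<le> i" "i < j" "j < k" "k \<le> int p + 1" using ist by (auto simp: j_def k_def)
  consider "s = j" "t = k" | "s = j" "t = - k" | "s = - j" "t = k" | "s = - j" "t = - k"
  proof -
    have "s = j \<or> s = - j" "t = k \<or> t = - k" unfolding j_def k_def by arith+
    then show ?thesis using that by blast
  qed
  then show ?thesis
  proof cases
    case 1
    then have "annular_triple p i j k" using ijk by (auto simp: annular_triple_def pos_def)
    then show ?thesis using ist(1) 1 by blast
  next
    case 2
    show ?thesis
    proof (cases "k = int p + 1")
      case True
      then have "annular_triple p i j (- k)" using ijk by (auto simp: annular_triple_def pos_def)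
      then show ?thesis using ist(1) 2 by blast
    next
      case False
      then have "annular_triple p k (- i) (- j)" using ijk by (auto simp: annular_triple_def pos_def)
      moreover have "{T, uminus ` T} = {{k, - i, - j}, uminus ` {k, - i, - j}}"
        unfolding ist(1) 2 by (simp add: insert_commute)
      ultimately show ?thesis by blast
    qed
  next
    case 3
    then have "{T, uminus ` T} = {{i, - j, k}, uminus ` {i, - j, k}}" using ist(1) by simp
    moreover have "k \<le> int (Suc p)" using ijk(4) by simp
    ultimately show ?thesis using ijk(1-3) by blast
  next
    case 4
    show ?thesis
    proof (cases "k = int p + 1")
      case True
      then have "annular_triple p j (- i) k" using ijk by (auto simp: annular_triple_def pos_def)
      moreover have "{T, uminus ` T} = {{j, - i, k}, uminus ` {j, - i, k}}"
        unfolding ist(1) 4 by (simp add: insert_commute)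
      ultimately show ?thesis by blast
    next
      case False
      then have "annular_triple p j k (- i)" using ijk by (auto simp: annular_triple_def pos_def)
      moreover have "{T, uminus ` T} = {{j, k, - i}, uminus ` {j, k, - i}}"
        unfolding ist(1) 4 by (simp add: insert_commute)
      ultimately show ?thesis by blast
    qed
  qed
qed

definition five_below :: "nat \<Rightarrow> int set set set \<Rightarrow> int set set set" where
  "five_below n X = {P \<in> X. card (down n X P) = 5}"

lemma order_isomorphic_card:
  assumes "order_isomorphic X (refines (signed n)) Y (refines (signed n))"
  shows "card (five_below n X) = card (five_below n Y)"
proof -
  obtain f where f: "bij_betw f X Y"
    and iso: "\<And>P Q. P \<in> X \<Longrightarrow> Q \<in> X \<Longrightarrow> refines (signed n) P Q \<longleftrightarrow> refines (signed n) (f P) (f Q)"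
    using assms by (auto simp: order_isomorphic_def)
  have inj: "inj_on f X" and im: "f ` X = Y" using f by (auto simp: bij_betw_def)
  have card: "card (down n Y (f P)) = card (down n X P)" if P: "P \<in> X" for P
  proof -
    have "down n Y (f P) = f ` down n X P"
      using im iso P by (auto simp: down_def)
    moreover have "inj_on f (down n X P)" by (rule inj_on_subset[OF inj]) (auto simp: down_def)
    ultimately show ?thesis by (simp add: card_image)
  qed
  have "five_below n Y = f ` five_below n X"
    using im card by (auto simp: five_below_def)
  moreover have "inj_on f (five_below n X)"
    by (rule inj_on_subset[OF inj]) (auto simp: five_below_def)
  ultimately show ?thesis by (simp add: card_image)
qed

text \<open>
  If \<open>p + 1\<close> is on a circle of its own, the pattern \<open>i, - j, p + 1\<close> is no longer crossing. The smallest
  instance \<open>1, - 2, p + 1\<close> needs \<open>p \<ge> 2\<close>.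
\<close>

lemma five_below_strict:
  assumes p: "2 \<le> p"
  shows "five_below (Suc p) (NC_B (Suc p)) \<subset> five_below (Suc p) (NC_B_annular p 1)"
proof -
  have p1: "1 \<le> p" using p by simp
  have "P \<in> five_below (Suc p) (NC_B_annular p 1)"
    if P: "P \<in> five_below (Suc p) (NC_B (Suc p))" for P
  proof -
    have PN: "P \<in> NC_B (Suc p)" "card (down (Suc p) (NC_B (Suc p)) P) = 5"
      using P by (auto simp: five_below_def)
    then obtain T where T: "T \<subseteq> signed (Suc p)" "card T = 3" "T \<inter> uminus ` T = {}"
      "P = with_blocks (Suc p) {T, uminus ` T}"
      using NC_B_down_five by blast
    from triple_annular_or_crossing[OF p1 T(1-3)] show ?thesis
    proof (elim disjE exE conjE)
      fix a b c assume "annular_triple p a b c" "{T, uminus ` T} = {{a, b, c}, uminus ` {a, b, c}}"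
      then show ?thesis using annular_triple_card[OF p1] T(4) by (simp add: five_below_def)
    next
      fix i j k assume "1 \<le> i" "i < j" "j < k" "k \<le> int (Suc p)"
        "{T, uminus ` T} = {{i, - j, k}, uminus ` {i, - j, k}}"
      then show ?thesis using crossing_triple[of i j k "Suc p"] PN(1) T(4) by simp
    qed
  qed
  \<comment> \<open>This is the triple \<open>1, - 2, p + 1\<close> up to sign.\<close>
  moreover define P where "P = with_blocks (Suc p) {{2, - 1, - (int p + 1)}, uminus ` {2, - 1, - (int p + 1)}}"
  have "annular_triple p 2 (- 1) (- (int p + 1))" using p by (auto simp: annular_triple_def pos_def)
  then have "P \<in> five_below (Suc p) (NC_B_annular p 1)"
    using annular_triple_card[OF p1] unfolding five_below_def P_def by blast
  moreover have "P \<notin> five_below (Suc p) (NC_B (Suc p))"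
  proof -
    have "{{2, - 1, - (int p + 1)}, uminus ` {2, - 1, - (int p + 1)}}
        = {{1, - 2, int p + 1}, uminus ` {1, - 2, int p + 1}}"
      by (simp add: insert_commute add.commute)
    then have "P \<notin> NC_B (Suc p)"
      using crossing_triple[of 1 2 "int p + 1" "Suc p"] p by (simp add: P_def)
    then show ?thesis by (simp add: five_below_def)
  qed
  ultimately show ?thesis by blast
qed

theorem mainTheorem3:
  fixes n :: nat
  assumes "n \<ge> 3"
  shows "\<not> order_isomorphic (NC_B_annular (n - 1) 1) (refines (signed n))
                            (NC_B n) (refines (signed n))"
proof
  assume iso: "order_isomorphic (NC_B_annular (n - 1) 1) (refines (signed n))
                            (NC_B n) (refines (signed n))"
  define p where "p = n - 1"
  have p: "n = Suc p" "2 \<le> p" using assms by (auto simp: p_def)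
  let ?A = "five_below n (NC_B_annular p 1)" and ?B = "five_below n (NC_B n)"
  have "finite ?A"
    by (rule finite_subset[OF _ finite_sym_partitions[of n]])
      (use annular_sym_partition[of _ p] in \<open>unfold five_below_def p(1), blast\<close>)
  moreover have "?B \<subset> ?A" using five_below_strict[OF p(2)] p(1) by simp
  ultimately have "card ?B < card ?A" by (rule psubset_card_mono)
  moreover have "card ?A = card ?B"
    using order_isomorphic_card[OF iso] by (simp add: p_def)
  ultimately show False by simp
qed

end
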